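(* Let $k\ge0$ and $d\ge 1$ with $d\geq 2k$. Then $\mathcal{W}_k(d)\subseteq\mathcal{K}_k(d)$.
   Context: Simplicial complexes are finite and contain the empty set as a face. For a finite set $\alpha$, $\overline{\alpha}$ is the complex of all subsets of $\alpha$, $\partial\alpha$ the complex of all proper subsets, and $\dim(\alpha)=\#(\alpha)-1$; $\ast$ denotes join. The standard sphere $S^d_{d+2}$ is the boundary complex of a $(d+1)$-simplex. Bistellar moves: let $X$ be $d$-dimensional and $\alpha,\beta$ disjoint non-empty finite sets with $\dim(\alpha)+\dim(\beta)=d$ such that the induced subcomplex of $X$ on $\alpha\sqcup\beta$ is $\overline{\alpha}\ast\partial\beta$ (if $\beta$ is a single vertex this means $\beta$ is a new vertex not in $X$). The complex $(X\setminus(\overline{\alpha}\ast\partial\beta))\cup(\partial\alpha\ast\overline{\beta})$ is obtained from $X$ by the bistellar move $\alpha\mapsto\beta$, of index $\dim(\beta)$. For $0\le k\le d+1$, a $d$-dimensional complex is a $k$-stellated $d$-sphere if it is obtained from $S^d_{d+2}$ by a finite (possibly empty) sequence of bistellar moves each of index $<k$. A homology sphere/ball means an $\mathbb{F}$-homology sphere/ball for some field $\mathbb{F}$. An $\mathbb{F}$-homology $d$-sphere is a $d$-dimensional complex in which the link of every face $\sigma$ (including $\emptyset$) has the reduced $\mathbb{F}$-homology of a $(d-\dim(\sigma)-1)$-sphere. An $\mathbb{F}$-homology $d$-ball is a $d$-dimensional $\mathbb{F}$-acyclic complex in which the link of every non-empty face $\sigma$ has the reduced homology of a $(d-\dim(\sigma)-1)$-sphere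 or of a point, and whose faces with acyclic link form an $\mathbb{F}$-homology $(d-1)$-sphere (its boundary). A homology $(d+1)$-ball is $k$-stacked if all its faces of codimension at least $k+1$ (dimension $\le d-k$) lie in its boundary; a homology $d$-sphere is $k$-stacked if it is the boundary of a $k$-stacked homology $(d+1)$-ball. $\mathcal{W}_k(d)$ (resp. $\mathcal{K}_k(d)$), $0\le k\le d$, is the class of connected $d$-dimensional simplicial complexes all of whose vertex-links are $k$-stellated $(d-1)$-spheres (resp. $k$-stacked homology $(d-1)$-spheres). *)

theory Defs
  imports "HOL-Algebra.AbelCoset" "HOL-Algebra.Module" "HOL-Library.Infinite_Typeclass"
begin

section \<open>Abstract simplicial complexes\<close>

type_synonym 'a complex = "'a set set"

definition simplicial_complex :: "'a complex \<Rightarrow> bool" where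
  "simplicial_complex X \<longleftrightarrow>
     finite X \<and> {} \<in> X \<and> (\<forall>\<sigma>\<in>X. finite \<sigma> \<and> (\<forall>\<tau>. \<tau> \<subseteq> \<sigma> \<longrightarrow> \<tau> \<in> X))"

text \<open>Dimensions are integers, so that the empty face has dimension \<open>-1\<close>.\<close>

definition face_dim :: "'a set \<Rightarrow> int" where
  "face_dim \<sigma> = int (card \<sigma>) - 1"

definition complex_dim :: "'a complex \<Rightarrow> int" where
  "complex_dim X = Max (face_dim ` X)"

definition dim_complex :: "int \<Rightarrow> 'a complex \<Rightarrow> bool" where
  "dim_complex d X \<longleftrightarrow> simplicial_complex X \<and> complex_dim X = d"

definition vertices :: "'a complex \<Rightarrow> 'a set" where
  "vertices X = {v. {v} \<in> X}"

definition full_simplex :: "'a set \<Rightarrow> 'a complex" where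
  "full_simplex \<alpha> = {\<sigma>. \<sigma> \<subseteq> \<alpha>}"

definition boundary_complex :: "'a set \<Rightarrow> 'a complex" where
  "boundary_complex \<alpha> = {\<sigma>. \<sigma> \<subset> \<alpha>}"

text \<open>Only used for complexes on disjoint vertex sets.\<close>

definition join :: "'a complex \<Rightarrow> 'a complex \<Rightarrow> 'a complex" where
  "join X Y = {\<sigma> \<union> \<tau> | \<sigma> \<tau>. \<sigma> \<in> X \<and> \<tau> \<in> Y}"

definition link :: "'a complex \<Rightarrow> 'a set \<Rightarrow> 'a complex" where
  "link X \<sigma> = {\<tau>. \<tau> \<inter> \<sigma> = {} \<and> \<tau> \<union> \<sigma> \<in> X}"

definition induced_subcomplex :: "'a complex \<Rightarrow> 'a set \<Rightarrow> 'a complex" where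
  "induced_subcomplex X A = {\<sigma> \<in> X. \<sigma> \<subseteq> A}"

text \<open>Connectedness of the geometric carrier, expressed by the edge graph.\<close>

definition connected_complex :: "'a complex \<Rightarrow> bool" where
  "connected_complex X \<longleftrightarrow>
     (\<forall>u \<in> vertices X. \<forall>v \<in> vertices X. (u, v) \<in> {(x, y). {x, y} \<in> X}\<^sup>*)"


section \<open>Bistellar moves and stellated spheres\<close>

text \<open>If \<open>\<beta>\<close> is a single vertex, then \<open>boundary_complex \<beta> = {{}}\<close>, and the condition on the
  induced subcomplex forces that vertex not to lie in \<open>X\<close>.\<close>

definition bistellar_move_admissible :: "int \<Rightarrow> 'a complex \<Rightarrow> 'a set \<Rightarrow> 'a set \<Rightarrow> bool" where
  "bistellar_move_admissible d X \<alpha> \<beta> \<longleftrightarrow>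
     dim_complex d X \<and> finite \<alpha> \<and> finite \<beta> \<and> \<alpha> \<noteq> {} \<and> \<beta> \<noteq> {} \<and> \<alpha> \<inter> \<beta> = {} \<and>
     face_dim \<alpha> + face_dim \<beta> = d \<and>
     induced_subcomplex X (\<alpha> \<union> \<beta>) = join (full_simplex \<alpha>) (boundary_complex \<beta>)"

definition bistellar_move :: "'a complex \<Rightarrow> 'a set \<Rightarrow> 'a set \<Rightarrow> 'a complex" where
  "bistellar_move X \<alpha> \<beta> =
     (X - join (full_simplex \<alpha>) (boundary_complex \<beta>)) \<union>
     join (boundary_complex \<alpha>) (full_simplex \<beta>)"

text \<open>Intended for \<open>0 \<le> k \<le> d + 1\<close>. The starting complex is a standard sphere, on any vertex set;
  the index of a move is \<open>face_dim \<beta>\<close>.\<close>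

inductive stellated_sphere :: "nat \<Rightarrow> int \<Rightarrow> 'a complex \<Rightarrow> bool" for k :: nat and d :: int where
  standard: "finite \<alpha> \<Longrightarrow> face_dim \<alpha> = d + 1 \<Longrightarrow> stellated_sphere k d (boundary_complex \<alpha>)"
| move: "stellated_sphere k d X \<Longrightarrow> bistellar_move_admissible d X \<alpha> \<beta> \<Longrightarrow> face_dim \<beta> < int k \<Longrightarrow>
    stellated_sphere k d (bistellar_move X \<alpha> \<beta>)"


section \<open>Reduced simplicial homology over a field\<close>

text \<open>A chain of degree \<open>i\<close> is a function on all vertex sets that vanishes off the \<open>i\<close>-dimensional
  faces. Faces are oriented by the linear order on the vertices. In degree \<open>-1\<close> the
  chain group is spanned by the empty face, whence the homology is reduced.\<close>

definition chain_module ::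
    "('r, 'm) ring_scheme \<Rightarrow> 'a complex \<Rightarrow> int \<Rightarrow> ('r, 'a set \<Rightarrow> 'r) module" where
  "chain_module F X i =
     \<lparr>carrier = {c. \<forall>\<sigma>. c \<sigma> \<in> carrier F \<and> (\<not> (\<sigma> \<in> X \<and> face_dim \<sigma> = i) \<longrightarrow> c \<sigma> = \<zero>\<^bsub>F\<^esub>)},
      mult = undefined, one = undefined,
      zero = (\<lambda>\<sigma>. \<zero>\<^bsub>F\<^esub>),
      add = (\<lambda>c c' \<sigma>. c \<sigma> \<oplus>\<^bsub>F\<^esub> c' \<sigma>),
      smult = (\<lambda>a c \<sigma>. a \<otimes>\<^bsub>F\<^esub> c \<sigma>)\<rparr>"

text \<open>The coefficient of \<open>\<tau>\<close> in the boundary of \<open>c\<close>: the face \<open>insert v \<tau>\<close> contributes with the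
  sign \<open>(-1)\<^sup>j\<close>, where \<open>j\<close> is the position of \<open>v\<close> in it, counted from \<open>0\<close>.\<close>

definition chain_boundary ::
    "('r, 'm) ring_scheme \<Rightarrow> 'a::linorder complex \<Rightarrow> ('a set \<Rightarrow> 'r) \<Rightarrow> ('a set \<Rightarrow> 'r)" where
  "chain_boundary F X c = (\<lambda>\<tau>. \<Oplus>\<^bsub>F\<^esub>v \<in> {v. v \<notin> \<tau> \<and> insert v \<tau> \<in> X}.
     if even (card {w \<in> \<tau>. w < v}) then c (insert v \<tau>) else \<ominus>\<^bsub>F\<^esub> c (insert v \<tau>))"

definition cycle_module ::
    "('r, 'm) ring_scheme \<Rightarrow> 'a::linorder complex \<Rightarrow> int \<Rightarrow> ('r, 'a set \<Rightarrow> 'r) module" where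
  "cycle_module F X i = (chain_module F X i)
     \<lparr>carrier := {c \<in> carrier (chain_module F X i). chain_boundary F X c = (\<lambda>\<tau>. \<zero>\<^bsub>F\<^esub>)}\<rparr>"

definition boundaries ::
    "('r, 'm) ring_scheme \<Rightarrow> 'a::linorder complex \<Rightarrow> int \<Rightarrow> ('a set \<Rightarrow> 'r) set" where
  "boundaries F X i = chain_boundary F X ` carrier (chain_module F X (i + 1))"

definition quotient_module :: "('r, 'b) module \<Rightarrow> 'b set \<Rightarrow> ('r, 'b set) module" where
  "quotient_module M N =
     \<lparr>carrier = a_rcosets\<^bsub>M\<^esub> N,
      mult = undefined, one = undefined,
      zero = N,
      add = (\<lambda>K L. K <+>\<^bsub>M\<^esub> L),
      smult = (\<lambda>a K. \<Union>x\<in>K. N +>\<^bsub>M\<^esub> (a \<odot>\<^bsub>M\<^esub> x))\<rparr>"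

definition reduced_homology ::
    "('r, 'm) ring_scheme \<Rightarrow> 'a::linorder complex \<Rightarrow> int \<Rightarrow> ('r, ('a set \<Rightarrow> 'r) set) module" where
  "reduced_homology F X i = quotient_module (cycle_module F X i) (boundaries F X i)"

definition isomorphic_to_field :: "('r, 'm) ring_scheme \<Rightarrow> ('r, 'b) module \<Rightarrow> bool" where
  "isomorphic_to_field F M \<longleftrightarrow>
     (\<exists>h. bij_betw h (carrier M) (carrier F) \<and>
        (\<forall>x \<in> carrier M. \<forall>y \<in> carrier M. h (x \<oplus>\<^bsub>M\<^esub> y) = h x \<oplus>\<^bsub>F\<^esub> h y) \<and>
        (\<forall>a \<in> carrier F. \<forall>x \<in> carrier M. h (a \<odot>\<^bsub>M\<^esub> x) = a \<otimes>\<^bsub>F\<^esub> h x))"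

definition acyclic_complex :: "('r, 'm) ring_scheme \<Rightarrow> 'a::linorder complex \<Rightarrow> bool" where
  "acyclic_complex F X \<longleftrightarrow>
     (\<forall>i. carrier (reduced_homology F X i) = {\<zero>\<^bsub>reduced_homology F X i\<^esub>})"

definition has_homology_of_sphere ::
    "('r, 'm) ring_scheme \<Rightarrow> int \<Rightarrow> 'a::linorder complex \<Rightarrow> bool" where
  "has_homology_of_sphere F n X \<longleftrightarrow>
     (\<forall>i. if i = n then isomorphic_to_field F (reduced_homology F X i)
          else carrier (reduced_homology F X i) = {\<zero>\<^bsub>reduced_homology F X i\<^esub>})"


section \<open>Homology spheres and balls, stackedness\<close>

definition homology_sphere_over ::
    "('r, 'm) ring_scheme \<Rightarrow> int \<Rightarrow> 'a::linorder complex \<Rightarrow> bool" where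
  "homology_sphere_over F d X \<longleftrightarrow>
     dim_complex d X \<and>
     (\<forall>\<sigma>\<in>X. has_homology_of_sphere F (d - face_dim \<sigma> - 1) (link X \<sigma>))"

definition ball_boundary ::
    "('r, 'm) ring_scheme \<Rightarrow> 'a::linorder complex \<Rightarrow> 'a complex" where
  "ball_boundary F B = {\<sigma> \<in> B. acyclic_complex F (link B \<sigma>)}"

text \<open>To have the reduced homology of a point is to be acyclic.\<close>

definition homology_ball_over ::
    "('r, 'm) ring_scheme \<Rightarrow> int \<Rightarrow> 'a::linorder complex \<Rightarrow> bool" where
  "homology_ball_over F d B \<longleftrightarrow>
     dim_complex d B \<and> acyclic_complex F B \<and>
     (\<forall>\<sigma>\<in>B. \<sigma> \<noteq> {} \<longrightarrow>
        has_homology_of_sphere F (d - face_dim \<sigma> - 1) (link B \<sigma>) \<or>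
        acyclic_complex F (link B \<sigma>)) \<and>
     homology_sphere_over F (d - 1) (ball_boundary F B)"

definition stacked_homology_ball_over ::
    "('r, 'm) ring_scheme \<Rightarrow> nat \<Rightarrow> int \<Rightarrow> 'a::linorder complex \<Rightarrow> bool" where
  "stacked_homology_ball_over F k d B \<longleftrightarrow>
     homology_ball_over F d B \<and>
     (\<forall>\<sigma>\<in>B. face_dim \<sigma> \<le> d - (int k + 1) \<longrightarrow> \<sigma> \<in> ball_boundary F B)"

text \<open>A homology sphere is an \<open>F\<close>-homology sphere for some field \<open>F\<close>. The quantifier ranges over
  the fields carried by a set of integers, which up to isomorphism are the countable fields. They
  include all prime fields, so no homology sphere or ball is lost: whether a finite complex is an
  \<open>F\<close>-homology sphere or ball, and what its boundary is, depends only on the characteristic of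
  \<open>F\<close>.\<close>

definition stacked_homology_sphere :: "nat \<Rightarrow> int \<Rightarrow> 'a::linorder complex \<Rightarrow> bool" where
  "stacked_homology_sphere k d S \<longleftrightarrow>
     (\<exists>F :: int ring. field F \<and> homology_sphere_over F d S \<and>
        (\<exists>B. stacked_homology_ball_over F k (d + 1) B \<and> S = ball_boundary F B))"


section \<open>The classes of complexes defined by their vertex links\<close>

text \<open>Both classes are intended for \<open>0 \<le> k \<le> d\<close>.\<close>

definition stellated_class :: "nat \<Rightarrow> nat \<Rightarrow> 'a complex set" (\<open>\<W>\<close>) where
  "\<W> k d = {X. dim_complex (int d) X \<and> connected_complex X \<and>
     (\<forall>v \<in> vertices X. stellated_sphere k (int d - 1) (link X {v}))}"

definition stacked_class :: "nat \<Rightarrow> nat \<Rightarrow> 'a::linorder complex set" (\<open>\<K>\<close>) where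
  "\<K> k d = {X. dim_complex (int d) X \<and> connected_complex X \<and>
     (\<forall>v \<in> vertices X. stacked_homology_sphere k (int d - 1) (link X {v}))}"

end

theory Submission
  imports Defs "HOL-Library.Z2" "HOL-Library.Function_Algebras" "HOL-Number_Theory.Residues"
begin

text \<open>A \<open>k\<close>-stellated sphere \<open>X\<close> of dimension \<open>e \<ge> 2 k - 1\<close> bounds a \<open>k\<close>-stacked ball \<open>B\<close>, built along
  with the bistellar moves: a move \<open>\<alpha> \<mapsto> \<beta>\<close> is accompanied by gluing the simplex on \<open>\<alpha> \<union> \<beta>\<close> to
  \<open>B\<close>. As \<open>\<beta>\<close> has at most \<open>k\<close> vertices and is not a face of \<open>X\<close>, stackedness of \<open>B\<close> and \<open>e \<ge> 2 k - 1\<close>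
  show that it is not a face of \<open>B\<close> either. So the simplex meets \<open>B\<close> exactly in
  \<open>\<alpha> * \<partial>\<beta>\<close>, and Mayer--Vietoris controls the homology of all links. Over the field with two
  elements no orientations are needed, and the fundamental cycle of a sphere is the sum of all its
  facets.\<close>

section \<open>Chains modulo 2\<close>

type_synonym 'a chain = "'a set \<Rightarrow> bit"

text \<open>The side condition of a move describes \<open>X\<close> only on \<alpha> \<union>
  \<beta>; it does not say that every face containing \<alpha> lies there, and any other such face
  would outlive its subface \<alpha>. So the induction must carry more than the ball: all links in
  \<open>X\<close> are spheres whose fundamental cycle is the sum of all facets, which is rigid
  enough to exclude such faces. Hence two notions of sphere: the weak one, with some homogeneous
  generator, is tracked for links of interior faces of the ball, the strong one for links in
  \<open>X\<close>. The same rigidity shows that cutting a ball out of a strong sphere leaves a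
  ball, so that the links in \<open>X\<close> stay spheres when one ball is exchanged for the other.
  Chains are not graded: the Mayer--Vietoris arguments treat all degrees at once, and degrees are
  separated where needed by cutting chains down to faces of one size. Sizes replace dimensions, so
  that the (-1)-sphere needs no negative index.\<close>

lemma chain_add_self [simp]: "c + c = (0 :: 'a chain)"
  by (simp add: fun_eq_iff)

lemma chain_add_self_left [simp]: "c + (c + d) = (d :: 'a chain)"
  by (simp add: fun_eq_iff)

lemma chain_add_eq_iff: "c + d = e \<longleftrightarrow> c = d + (e :: 'a chain)"
  by (metis add.commute chain_add_self_left)

definition chain_on :: "'a complex \<Rightarrow> 'a chain \<Rightarrow> bool" where
  "chain_on X c \<longleftrightarrow> (\<forall>\<sigma>. \<sigma> \<notin> X \<longrightarrow> c \<sigma> = 0)"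

text \<open>The complex does not enter, so a chain has literally the same boundary in a subcomplex
  and in a union. Summing over the support keeps the sum finite for chains on a finite complex. The
  empty face receives the sum of the vertex coefficients, so the homology is reduced.\<close>

definition bd :: "'a chain \<Rightarrow> 'a chain" where
  "bd c = (\<lambda>\<tau>. \<Sum>v | v \<notin> \<tau> \<and> c (insert v \<tau>) \<noteq> 0. c (insert v \<tau>))"

definition restrict_chain :: "'a chain \<Rightarrow> 'a complex \<Rightarrow> 'a chain" where
  "restrict_chain c A = (\<lambda>\<sigma>. if \<sigma> \<in> A then c \<sigma> else 0)"

lemma chain_on_0 [simp]: "chain_on X 0"
  by (simp add: chain_on_def)

lemma chain_on_add: "chain_on X c \<Longrightarrow> chain_on X d \<Longrightarrow> chain_on X (c + d)"
  by (simp add: chain_on_def)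

lemma chain_on_mono: "chain_on X c \<Longrightarrow> X \<subseteq> Y \<Longrightarrow> chain_on Y c"
  by (auto simp: chain_on_def)

lemma chain_on_Int: "chain_on X c \<Longrightarrow> chain_on Y c \<Longrightarrow> chain_on (X \<inter> Y) c"
  by (auto simp: chain_on_def)

lemma chain_on_Un_split:
  assumes "chain_on (A \<union> B) c"
  obtains a b where "chain_on A a" "chain_on B b" "c = a + b" "\<And>\<sigma>. a \<sigma> \<noteq> 0 \<Longrightarrow> c \<sigma> \<noteq> 0"
    "\<And>\<sigma>. b \<sigma> \<noteq> 0 \<Longrightarrow> c \<sigma> \<noteq> 0"
proof
  show "chain_on A (restrict_chain c A)" "chain_on B (restrict_chain c (- A))"
    "c = restrict_chain c A + restrict_chain c (- A)"
    using assms by (auto simp: chain_on_def restrict_chain_def fun_eq_iff)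
qed (auto simp: restrict_chain_def split: if_splits)

text \<open>Replaces the support, which varies with the chain, by a fixed finite index set, so that
  boundaries of different chains can be compared termwise.\<close>

lemma bd_eq_sum:
  assumes "finite V" "\<Union>X \<subseteq> V" "chain_on X c"
  shows "bd c \<tau> = (\<Sum>v\<in>V - \<tau>. c (insert v \<tau>))"
  unfolding bd_def
proof (rule sum.mono_neutral_left)
  show "{v. v \<notin> \<tau> \<and> c (insert v \<tau>) \<noteq> 0} \<subseteq> V - \<tau>"
    using assms by (auto simp: chain_on_def) (metis UnionI insertI1 subsetD zero_neq_one)
qed (use assms in auto)

lemma finite_Union_complex: "simplicial_complex X \<Longrightarrow> finite (\<Union>X)"
  by (auto simp: simplicial_complex_def)

lemma face_finite: "simplicial_complex X \<Longrightarrow> \<sigma> \<in> X \<Longrightarrow> finite \<sigma>"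
  by (auto simp: simplicial_complex_def)

lemma face_subset: "simplicial_complex X \<Longrightarrow> \<sigma> \<in> X \<Longrightarrow> \<tau> \<subseteq> \<sigma> \<Longrightarrow> \<tau> \<in> X"
  by (auto simp: simplicial_complex_def)

lemma empty_face: "simplicial_complex X \<Longrightarrow> {} \<in> X"
  by (auto simp: simplicial_complex_def)

lemma simplicial_complex_Un:
  "simplicial_complex X \<Longrightarrow> simplicial_complex Y \<Longrightarrow> simplicial_complex (X \<union> Y)"
  by (auto simp: simplicial_complex_def)

lemma simplicial_complex_Pow: "finite W \<Longrightarrow> simplicial_complex (Pow W)"
  by (auto simp: simplicial_complex_def intro: finite_subset)

lemma bd_add:
  assumes "simplicial_complex X" "chain_on X c" "chain_on X d"
  shows "bd (c + d) = bd c + bd d"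
proof
  fix \<tau>
  note eq = bd_eq_sum[OF finite_Union_complex[OF assms(1)] subset_refl]
  show "bd (c + d) \<tau> = (bd c + bd d) \<tau>"
    by (simp only: plus_fun_apply eq[OF assms(2)] eq[OF assms(3)] eq[OF chain_on_add[OF assms(2,3)]]
        sum.distrib)
qed

lemma bd_0 [simp]: "bd 0 = 0"
  by (simp add: bd_def fun_eq_iff)

lemma bd_nonzeroE:
  assumes "bd c \<tau> \<noteq> 0"
  obtains v where "v \<notin> \<tau>" "c (insert v \<tau>) \<noteq> 0"
  using assms unfolding bd_def by (metis (mono_tags, lifting) empty_Collect_eq sum.empty)

lemma chain_on_bd:
  assumes "simplicial_complex X" "chain_on X c"
  shows "chain_on X (bd c)"
  unfolding chain_on_def
proof (intro allI impI)
  fix \<tau> assume "\<tau> \<notin> X"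
  then show "bd c \<tau> = 0"
    using assms(2) face_subset[OF assms(1) _ subset_insertI[of \<tau>]]
    unfolding chain_on_def by (metis bd_nonzeroE)
qed

text \<open>Each coefficient is a sum over ordered pairs of distinct vertices; swapping a pair
  preserves its term, so the two halves cancel modulo 2. The linear order serves to choose the
  halves.\<close>

lemma bd_bd:
  fixes c :: "'a::linorder chain"
  assumes "simplicial_complex X" "chain_on X c"
  shows "bd (bd c) = 0"
proof
  fix \<tau>
  define V where "V = \<Union>X - \<tau>"
  have fin: "finite V"
    using finite_Union_complex[OF assms(1)] by (simp add: V_def)
  note eq = bd_eq_sum[OF finite_Union_complex[OF assms(1)] subset_refl]
  define g where "g = (\<lambda>(v, w). c (insert w (insert v \<tau>)))"
  define L where "L = {(v, w). v \<in> V \<and> w \<in> V \<and> v < w}"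
  define G where "G = {(v, w). v \<in> V \<and> w \<in> V \<and> w < v}"
  have fins: "finite L" "finite G"
    using fin by (auto simp: L_def G_def intro: finite_subset[of _ "V \<times> V"])
  have "bd (bd c) \<tau> = (\<Sum>v\<in>V. \<Sum>w\<in>V - {v}. g (v, w))"
    unfolding eq[OF chain_on_bd[OF assms]] V_def eq[OF assms(2)] g_def
    by (intro sum.cong) (auto intro!: sum.cong)
  also have "\<dots> = sum g (SIGMA v:V. V - {v})"
    using fin by (subst sum.Sigma) (auto intro!: sum.cong)
  also have "(SIGMA v:V. V - {v}) = L \<union> G"
    by (auto simp: L_def G_def)
  also have "sum g (L \<union> G) = sum g L + sum g G"
    using fins by (intro sum.union_disjoint) (auto simp: L_def G_def)
  also have "sum g G = sum g L"
    by (rule sum.reindex_bij_witness[of _ prod.swap prod.swap])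
      (auto simp: L_def G_def g_def insert_commute)
  finally show "bd (bd c) \<tau> = 0 \<tau>"
    by simp
qed


section \<open>Acyclic complexes, spheres and balls modulo 2\<close>

definition mod2_acyclic :: "'a complex \<Rightarrow> bool" where
  "mod2_acyclic X \<longleftrightarrow> (\<forall>z. chain_on X z \<longrightarrow> bd z = 0 \<longrightarrow> (\<exists>y. chain_on X y \<and> bd y = z))"

text \<open>Total reduced homology of dimension one, with a named generator: over two elements the
  alternatives \<open>z = bd y\<close> and \<open>z = bd y + f\<close> are the two classes.\<close>

definition generated_by_cycle :: "'a complex \<Rightarrow> 'a chain \<Rightarrow> bool" where
  "generated_by_cycle X f \<longleftrightarrow> chain_on X f \<and> bd f = 0 \<and> (\<nexists>y. chain_on X y \<and> bd y = f) \<and>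
     (\<forall>z. chain_on X z \<longrightarrow> bd z = 0 \<longrightarrow> (\<exists>y. chain_on X y \<and> (z = bd y \<or> z = bd y + f)))"

definition faces_chain :: "nat \<Rightarrow> 'a complex \<Rightarrow> 'a chain" where
  "faces_chain n X = (\<lambda>\<sigma>. of_bool (\<sigma> \<in> X \<and> card \<sigma> = n))"

text \<open>The parameter \<open>n\<close> is the number of vertices of a facet, so one more than the dimension.\<close>

definition weak_sphere :: "nat \<Rightarrow> 'a complex \<Rightarrow> bool" where
  "weak_sphere n X \<longleftrightarrow> (\<exists>f. generated_by_cycle X f \<and> (\<forall>\<sigma>. f \<sigma> \<noteq> 0 \<longrightarrow> card \<sigma> = n))"

text \<open>Naming the generator turns homology into information on single facets: as no face has
  more than \<open>n\<close> vertices, boundaries vanish on the faces with \<open>n\<close>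
  vertices.\<close>

definition strong_sphere :: "nat \<Rightarrow> 'a complex \<Rightarrow> bool" where
  "strong_sphere n X \<longleftrightarrow> (\<forall>\<sigma>\<in>X. card \<sigma> \<le> n) \<and> generated_by_cycle X (faces_chain n X)"

text \<open>The homological trace of an \<open>n\<close>-dimensional ball with boundary sphere
  \<open>S\<close>: the sum of the facets of \<open>D\<close> is a relative fundamental cycle. The
  size bound inside \<open>strong_sphere\<close> keeps the facets of \<open>D\<close> out of
  \<open>S\<close>.\<close>

definition ball_pair :: "nat \<Rightarrow> 'a complex \<Rightarrow> 'a complex \<Rightarrow> bool" where
  "ball_pair n D S \<longleftrightarrow> (\<forall>\<sigma>\<in>D. card \<sigma> \<le> Suc n) \<and> mod2_acyclic D \<and> S \<subseteq> D \<and> strong_sphere n S \<and>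
     bd (faces_chain (Suc n) D) = faces_chain n S"

lemma chain_on_faces_chain: "chain_on X (faces_chain n X)"
  by (simp add: chain_on_def faces_chain_def)

lemma strong_sphere_imp_weak_sphere: "strong_sphere n X \<Longrightarrow> weak_sphere n X"
  unfolding strong_sphere_def weak_sphere_def
  by (intro exI[of _ "faces_chain n X"]) (auto simp: faces_chain_def)

lemma mod2_acyclicD:
  assumes "mod2_acyclic X" "chain_on X z" "bd z = 0"
  obtains y where "chain_on X y" "bd y = z"
  using assms unfolding mod2_acyclic_def by blast

lemma generated_by_cycleD:
  assumes "generated_by_cycle X f" "chain_on X z" "bd z = 0"
  obtains y where "chain_on X y" "z = bd y \<or> z = bd y + f"
  using assms unfolding generated_by_cycle_def by blast

section \<open>Mayer--Vietoris arguments for two pieces\<close>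

text \<open>The parts of a cycle on \<open>A\<close> and on \<open>B\<close> have the same boundary,
  a cycle of the intersection and hence equal to some \<open>bd w\<close> there; adding
  \<open>w\<close> closes both parts.\<close>

lemma mod2_acyclic_Un:
  fixes A B :: "'a::linorder complex"
  assumes cA: "simplicial_complex A" and cB: "simplicial_complex B"
    and A: "mod2_acyclic A" and B: "mod2_acyclic B" and AB: "mod2_acyclic (A \<inter> B)"
  shows "mod2_acyclic (A \<union> B)"
  unfolding mod2_acyclic_def
proof (intro allI impI)
  note cU = simplicial_complex_Un[OF cA cB]
  note mono = chain_on_mono[of A _ "A \<union> B"] chain_on_mono[of B _ "A \<union> B"]
  fix z assume z: "chain_on (A \<union> B) z" "bd z = 0"
  obtain a b where ab: "chain_on A a" "chain_on B b" "z = a + b"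
    using chain_on_Un_split[OF z(1)] by metis
  have "bd a + bd b = 0"
    using z(2) bd_add[OF cU, of a b] ab mono by auto
  then have eq: "bd a = bd b"
    by (simp add: chain_add_eq_iff)
  then have "chain_on (A \<inter> B) (bd a)"
    using chain_on_bd[OF cA ab(1)] chain_on_bd[OF cB ab(2)] by (simp add: chain_on_Int)
  then obtain w where w: "chain_on (A \<inter> B) w" "bd w = bd a"
    using AB bd_bd[OF cA ab(1)] mod2_acyclicD by metis
  have wA: "chain_on A w" and wB: "chain_on B w"
    using w chain_on_mono by blast+
  obtain p where p: "chain_on A p" "bd p = a + w"
    using mod2_acyclicD[OF A chain_on_add[OF ab(1) wA]] bd_add[OF cA ab(1) wA] w by auto
  obtain q where q: "chain_on B q" "bd q = b + w"
    using mod2_acyclicD[OF B chain_on_add[OF ab(2) wB]] bd_add[OF cB ab(2) wB] w eq by auto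
  have "bd (p + q) = z"
    using bd_add[OF cU, of p q] mono p q ab by (simp add: ac_simps)
  then show "\<exists>y. chain_on (A \<union> B) y \<and> bd y = z"
    using p q mono chain_on_add[of "A \<union> B" p q] by blast
qed

text \<open>The connecting map is an isomorphism when both pieces are acyclic; explicitly,
  \<open>a\<close> and \<open>b\<close> are hemispheres with common equator
  \<open>s\<close>.\<close>

lemma generated_by_cycle_Un:
  fixes A B :: "'a::linorder complex"
  assumes cA: "simplicial_complex A" and cB: "simplicial_complex B"
    and A: "mod2_acyclic A" and B: "mod2_acyclic B" and AB: "generated_by_cycle (A \<inter> B) s"
    and ab: "chain_on A a" "chain_on B b" "bd a = s" "bd b = s"
  shows "generated_by_cycle (A \<union> B) (a + b)"
  unfolding generated_by_cycle_def
proof (intro conjI allI impI notI)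
  note cU = simplicial_complex_Un[OF cA cB]
  note mono = chain_on_mono[of A _ "A \<union> B", OF _ Un_upper1] chain_on_mono[of B _ "A \<union> B", OF _ Un_upper2]
  show "chain_on (A \<union> B) (a + b)"
    using ab mono by (intro chain_on_add) auto
  show "bd (a + b) = 0"
    using bd_add[OF cU, of a b] mono ab by simp
  {
    assume "\<exists>y. chain_on (A \<union> B) y \<and> bd y = a + b"
    then obtain y where y: "chain_on (A \<union> B) y" "bd y = a + b"
      by blast
    obtain p q where pq: "chain_on A p" "chain_on B q" "y = p + q"
      using chain_on_Un_split[OF y(1)] by metis
    have "a + b = bd p + bd q"
      using y bd_add[OF cU, of p q] pq mono by simp
    \<comment> \<open>One side lives on \<open>A\<close>, the other on \<open>B\<close>; their
      common value would be a chain of the intersection with boundary \<open>s\<close>.\<close>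
    then have eq: "a + bd p = b + bd q"
      by (metis add.assoc add.commute chain_add_self_left)
    have "chain_on (A \<inter> B) (a + bd p)"
      using chain_on_add[OF ab(1) chain_on_bd[OF cA pq(1)]]
        chain_on_add[OF ab(2) chain_on_bd[OF cB pq(2)]] eq by (simp add: chain_on_Int)
    moreover have "bd (a + bd p) = s"
      using bd_add[OF cA ab(1) chain_on_bd[OF cA pq(1)]] bd_bd[OF cA pq(1)] ab by simp
    ultimately show False
      using AB unfolding generated_by_cycle_def by blast
  }
  fix z assume z: "chain_on (A \<union> B) z" "bd z = 0"
  obtain p q where pq: "chain_on A p" "chain_on B q" "z = p + q"
    using chain_on_Un_split[OF z(1)] by metis
  have "bd p + bd q = 0"
    using z(2) bd_add[OF cU, of p q] pq mono by simp
  then have eq: "bd p = bd q"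
    by (simp add: chain_add_eq_iff)
  then have "chain_on (A \<inter> B) (bd p)"
    using chain_on_bd[OF cA pq(1)] chain_on_bd[OF cB pq(2)] by (simp add: chain_on_Int)
  then obtain w where w: "chain_on (A \<inter> B) w" "bd p = bd w \<or> bd p = bd w + s"
    using AB bd_bd[OF cA pq(1)] generated_by_cycleD by metis
  have wA: "chain_on A w" and wB: "chain_on B w"
    using w chain_on_mono by blast+
  \<comment> \<open>\<open>e\<close> records the class of \<open>bd p\<close>, hence of
    \<open>z\<close>, in the one-dimensional homology; if it holds, the hemispheres are added as a
    correction.\<close>
  define e where "e = (bd p \<noteq> bd w)"
  define a' b' where "a' = (if e then a else 0)" and "b' = (if e then b else 0)"
  have a': "chain_on A a'" "chain_on B b'" "bd p = bd w + bd a'" "bd b' = bd a'"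
    using ab w by (auto simp: a'_def b'_def e_def)
  have "bd (p + (w + a')) = 0"
    using bd_add[OF cA pq(1) chain_on_add[OF wA a'(1)]] bd_add[OF cA wA a'(1)] a' by simp
  then obtain u where u: "chain_on A u" "bd u = p + (w + a')"
    using mod2_acyclicD[OF A] chain_on_add[OF pq(1) chain_on_add[OF wA a'(1)]] by metis
  have "bd (q + (w + b')) = 0"
    using bd_add[OF cB pq(2) chain_on_add[OF wB a'(2)]] bd_add[OF cB wB a'(2)] a' eq by simp
  then obtain v where v: "chain_on B v" "bd v = q + (w + b')"
    using mod2_acyclicD[OF B] chain_on_add[OF pq(2) chain_on_add[OF wB a'(2)]] by metis
  have "bd (u + v) = p + (w + a') + (q + (w + b'))"
    using bd_add[OF cU, of u v] mono u v by simp
  also have "\<dots> = z + (a' + b')"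
    unfolding pq(3) by (simp add: ac_simps)
  finally have "z = bd (u + v) \<or> z = bd (u + v) + (a + b)"
    unfolding a'_def b'_def by (cases e) (simp_all add: add.assoc)
  then show "\<exists>y. chain_on (A \<union> B) y \<and> (z = bd y \<or> z = bd y + (a + b))"
    using u v mono chain_on_add[of "A \<union> B" u v] by blast
qed

text \<open>The same connecting isomorphism read backwards: a sphere cut into two acyclic pieces has
  a sphere as its seam. This gives the homology of \<partial>\<alpha> * \<partial>\<beta> without
  computing that of a join.\<close>

lemma generated_by_cycle_Int:
  fixes A B :: "'a::linorder complex"
  assumes cA: "simplicial_complex A" and cB: "simplicial_complex B"
    and A: "mod2_acyclic A" and B: "mod2_acyclic B" and AB: "generated_by_cycle (A \<union> B) (a + b)"
    and ab: "chain_on A a" "chain_on B b"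
  shows "generated_by_cycle (A \<inter> B) (bd a)"
  unfolding generated_by_cycle_def
proof (intro conjI allI impI notI)
  note cU = simplicial_complex_Un[OF cA cB]
  note mono = chain_on_mono[of A _ "A \<union> B", OF _ Un_upper1] chain_on_mono[of B _ "A \<union> B", OF _ Un_upper2]
  have "bd (a + b) = 0"
    using AB by (simp add: generated_by_cycle_def)
  then have "bd a + bd b = 0"
    using bd_add[OF cU, of a b] mono ab by simp
  then have eq: "bd a = bd b"
    by (simp add: chain_add_eq_iff)
  then show "chain_on (A \<inter> B) (bd a)"
    using chain_on_bd[OF cA ab(1)] chain_on_bd[OF cB ab(2)] by (simp add: chain_on_Int)
  show "bd (bd a) = 0"
    by (rule bd_bd[OF cA ab(1)])
  {
    assume "\<exists>y. chain_on (A \<inter> B) y \<and> bd y = bd a"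
    then obtain w where w: "chain_on (A \<inter> B) w" "bd w = bd a"
      by blast
    have wA: "chain_on A w" and wB: "chain_on B w"
      using w chain_on_mono by blast+
    obtain p where p: "chain_on A p" "bd p = a + w"
      using mod2_acyclicD[OF A chain_on_add[OF ab(1) wA]] bd_add[OF cA ab(1) wA] w by auto
    obtain q where q: "chain_on B q" "bd q = b + w"
      using mod2_acyclicD[OF B chain_on_add[OF ab(2) wB]] bd_add[OF cB ab(2) wB] w eq by auto
    have "bd (p + q) = a + b"
      using bd_add[OF cU, of p q] mono p q by (simp add: ac_simps)
    then show False
      using AB p q mono chain_on_add[of "A \<union> B" p q] unfolding generated_by_cycle_def by blast
  }
  fix z assume z: "chain_on (A \<inter> B) z" "bd z = 0"
  have zA: "chain_on A z" and zB: "chain_on B z"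
    using z chain_on_mono by blast+
  obtain p q where p: "chain_on A p" "bd p = z" and q: "chain_on B q" "bd q = z"
    using mod2_acyclicD[OF A zA z(2)] mod2_acyclicD[OF B zB z(2)] by metis
  have "chain_on (A \<union> B) (p + q)" "bd (p + q) = 0"
    using bd_add[OF cU, of p q] p q mono chain_on_add[of "A \<union> B" p q] by auto
  then obtain y where y: "chain_on (A \<union> B) y" "p + q = bd y \<or> p + q = bd y + (a + b)"
    using AB generated_by_cycleD by metis
  obtain u v where uv: "chain_on A u" "chain_on B v" "y = u + v"
    using chain_on_Un_split[OF y(1)] by metis
  define e where "e = (p + q \<noteq> bd y)"
  define a' b' where "a' = (if e then a else 0)" and "b' = (if e then b else 0)"
  have a': "chain_on A a'" "chain_on B b'"
    using ab by (auto simp: a'_def b'_def)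
  have "p + q = bd y + (a' + b')"
    using y by (auto simp: a'_def b'_def e_def)
  also have "bd y = bd u + bd v"
    using bd_add[OF cU, of u v] uv mono by simp
  finally have "p + q = bd u + bd v + (a' + b')" .
  then have "p = q + (bd u + bd v + (a' + b'))"
    by (metis add.commute chain_add_eq_iff)
  \<comment> \<open>Separating the terms on \<open>A\<close> from those on \<open>B\<close> yields a
    chain of the intersection whose boundary is \<open>z\<close> up to \<open>bd a'\<close>.\<close>
  then have eq': "p + (bd u + a') = q + (bd v + b')"
    by (simp add: ac_simps)
  have pA: "chain_on A (p + (bd u + a'))"
    by (intro chain_on_add chain_on_bd p cA uv a')
  have "chain_on B (q + (bd v + b'))"
    by (intro chain_on_add chain_on_bd q cB uv a')
  then have "chain_on (A \<inter> B) (p + (bd u + a'))"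
    using pA eq' by (simp add: chain_on_Int)
  moreover have "bd (p + (bd u + a')) = z + bd a'"
    using bd_add[OF cA p(1) chain_on_add[OF chain_on_bd[OF cA uv(1)] a'(1)]]
      bd_add[OF cA chain_on_bd[OF cA uv(1)] a'(1)] bd_bd[OF cA uv(1)] p by simp
  ultimately show "\<exists>y. chain_on (A \<inter> B) y \<and> (z = bd y \<or> z = bd y + bd a)"
    by (intro exI[of _ "p + (bd u + a')"]) (auto simp: a'_def add.assoc)
qed

lemma faces_chain_Un:
  assumes "\<And>\<sigma>. \<sigma> \<in> A \<Longrightarrow> \<sigma> \<in> B \<Longrightarrow> card \<sigma> \<noteq> n"
  shows "faces_chain n (A \<union> B) = faces_chain n A + faces_chain n B"
  using assms by (auto simp: faces_chain_def fun_eq_iff)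

text \<open>Faces of the intersection are too small to be facets of either ball, so the fundamental
  cycle of the union is the sum of the two relative cycles.\<close>

lemma strong_sphere_Un:
  fixes A B :: "'a::linorder complex"
  assumes "simplicial_complex A" "simplicial_complex B"
    and "ball_pair n A (A \<inter> B)" "ball_pair n B (A \<inter> B)"
  shows "strong_sphere (Suc n) (A \<union> B)"
proof -
  have "generated_by_cycle (A \<union> B) (faces_chain (Suc n) A + faces_chain (Suc n) B)"
    using assms
    by (intro generated_by_cycle_Un[of A B "faces_chain n (A \<inter> B)"])
      (auto simp: ball_pair_def strong_sphere_def chain_on_faces_chain)
  moreover have "faces_chain (Suc n) (A \<union> B) = faces_chain (Suc n) A + faces_chain (Suc n) B"
    using assms by (intro faces_chain_Un) (force simp: ball_pair_def strong_sphere_def)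
  ultimately show ?thesis
    using assms by (auto simp: strong_sphere_def ball_pair_def)
qed

text \<open>Only the fundamental cycle of the sphere prevents the complement of \<open>D\<close> from being acyclic,
  and it is not supported there.\<close>

lemma ball_pair_complement:
  fixes R D :: "'a::linorder complex"
  assumes cR: "simplicial_complex R" and cD: "simplicial_complex D"
    and U: "strong_sphere (Suc n) (R \<union> D)" and D: "ball_pair n D (R \<inter> D)"
  shows "ball_pair n R (R \<inter> D)"
proof -
  note cU = simplicial_complex_Un[OF cR cD]
  note mono = chain_on_mono[of R _ "R \<union> D", OF _ Un_upper1] chain_on_mono[of D _ "R \<union> D", OF _ Un_upper2]
  let ?F = "faces_chain (Suc n) (R \<union> D)" and ?s = "faces_chain n (R \<inter> D)"
  have S: "\<And>\<sigma>. \<sigma> \<in> R \<inter> D \<Longrightarrow> card \<sigma> \<le> n" "generated_by_cycle (R \<inter> D) ?s"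
    using D by (auto simp: ball_pair_def strong_sphere_def)
  have F: "generated_by_cycle (R \<union> D) ?F" "\<And>\<sigma>. \<sigma> \<in> R \<union> D \<Longrightarrow> card \<sigma> \<le> Suc n"
    using U by (auto simp: strong_sphere_def)
  have split: "?F = faces_chain (Suc n) R + faces_chain (Suc n) D"
    using S(1) by (intro faces_chain_Un) force
  have "bd (faces_chain (Suc n) R) + bd (faces_chain (Suc n) D) = bd ?F"
    unfolding split by (intro bd_add[OF cU, symmetric] mono chain_on_faces_chain)
  also have "bd ?F = 0"
    using F by (simp add: generated_by_cycle_def)
  finally have bdR: "bd (faces_chain (Suc n) R) = ?s"
    using D by (simp add: ball_pair_def chain_add_eq_iff)
  have "?s \<noteq> 0"
    using S(2) by (auto simp: generated_by_cycle_def)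
  then have "faces_chain (Suc n) D \<noteq> 0"
    using D by (auto simp: ball_pair_def)
  \<comment> \<open>A test face: chains on \<open>R\<close> vanish at \<phi>, and boundaries vanish
    there since no face has more than \<open>Suc n\<close> vertices, but the fundamental cycle does
    not. Hence it cannot occur in a cycle on \<open>R\<close>.\<close>
  then obtain \<phi> where \<phi>: "\<phi> \<in> D" "card \<phi> = Suc n"
    by (auto simp: faces_chain_def fun_eq_iff)
  then have \<phi>R: "\<phi> \<notin> R"
    using S(1)[of \<phi>] by auto
  have "mod2_acyclic R"
    unfolding mod2_acyclic_def
  proof (intro allI impI)
    fix z assume z: "chain_on R z" "bd z = 0"
    obtain y where y: "chain_on (R \<union> D) y" "z = bd y \<or> z = bd y + ?F"
      using generated_by_cycleD[OF F(1) mono(1)[OF z(1)] z(2)] by metis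
    have "bd y \<phi> = 0"
    proof (rule ccontr)
      assume "bd y \<phi> \<noteq> 0"
      then obtain v where "v \<notin> \<phi>" "insert v \<phi> \<in> R \<union> D"
        using y(1) unfolding chain_on_def by (metis bd_nonzeroE)
      then show False
        using F(2)[of "insert v \<phi>"] \<phi> face_finite[OF cD \<phi>(1)] by simp
    qed
    moreover have "z \<phi> = 0" "?F \<phi> = 1"
      using z \<phi>R \<phi> by (auto simp: chain_on_def faces_chain_def)
    ultimately have zy: "z = bd y"
      using y(2) by auto
    obtain p q where pq: "chain_on R p" "chain_on D q" "y = p + q"
      using chain_on_Un_split[OF y(1)] by metis
    have "z = bd p + bd q"
      using zy pq mono bd_add[OF cU, of p q] by simp
    then have eq: "bd q = z + bd p"
      by (simp add: ac_simps)
    then have "chain_on (R \<inter> D) (bd q)"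
      using chain_on_bd[OF cD pq(2)] chain_on_add[OF z(1) chain_on_bd[OF cR pq(1)]]
      by (simp add: chain_on_Int)
    then obtain w where w: "chain_on (R \<inter> D) w" "bd q = bd w \<or> bd q = bd w + ?s"
      using generated_by_cycleD[OF S(2)] bd_bd[OF cD pq(2)] by metis
    have wR: "chain_on R w"
      using w chain_on_mono by blast
    \<comment> \<open>\<open>bd q\<close> may differ from a boundary in \<open>R \<inter> D\<close>
      by the cycle of the common sphere; the facets of \<open>R\<close> bound that cycle inside
      \<open>R\<close>.\<close>
    define f where "f = (if bd q = bd w then 0 else faces_chain (Suc n) R)"
    have f: "chain_on R f" "bd q = bd w + bd f"
      using w bdR by (auto simp: f_def chain_on_faces_chain)
    have "bd (p + (w + f)) = bd p + (bd w + bd f)"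
      using bd_add[OF cR pq(1) chain_on_add[OF wR f(1)]] bd_add[OF cR wR f(1)] by simp
    also have "\<dots> = z"
      using f eq by (metis add.commute chain_add_self_left)
    finally show "\<exists>y. chain_on R y \<and> bd y = z"
      using chain_on_add[OF pq(1) chain_on_add[OF wR f(1)]] by blast
  qed
  then show ?thesis
    using D F(2) bdR by (auto simp: ball_pair_def)
qed

section \<open>Cones, simplices and the two balls exchanged by a move\<close>

text \<open>The cone operator is a contracting homotopy: \<open>y\<close> joins the apex
  \<open>a\<close> to the part of \<open>z\<close> that avoids it.\<close>

lemma mod2_acyclic_cone:
  assumes X: "simplicial_complex X" and cone: "\<And>\<sigma>. \<sigma> \<in> X \<Longrightarrow> insert a \<sigma> \<in> X"
  shows "mod2_acyclic X"
  unfolding mod2_acyclic_def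
proof (intro allI impI)
  fix z assume z: "chain_on X z" "bd z = 0"
  note fin = finite_Union_complex[OF X] and eq = bd_eq_sum[OF finite_Union_complex[OF X] subset_refl]
  have a: "a \<in> \<Union>X"
    using cone[OF empty_face[OF X]] by auto
  define y where "y = (\<lambda>\<sigma>. if a \<in> \<sigma> then z (\<sigma> - {a}) else 0)"
  have y: "chain_on X y"
    unfolding chain_on_def
  proof (intro allI impI)
    fix \<sigma> assume "\<sigma> \<notin> X"
    then have "a \<in> \<sigma> \<Longrightarrow> \<sigma> - {a} \<notin> X"
      using cone[of "\<sigma> - {a}"] by (auto simp: insert_absorb)
    then show "y \<sigma> = 0"
      using z(1) by (auto simp: y_def chain_on_def)
  qed
  have "bd y \<tau> = z \<tau>" for \<tau>
  proof (cases "a \<in> \<tau>")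
    case False
    have "bd y \<tau> = (\<Sum>v\<in>\<Union>X - \<tau>. y (insert v \<tau>))"
      by (rule eq[OF y])
    also have "\<dots> = (\<Sum>v\<in>{a}. y (insert v \<tau>))"
      using fin a False by (intro sum.mono_neutral_right) (auto simp: y_def)
    finally show ?thesis
      using False by (simp add: y_def)
  next
    case True
    \<comment> \<open>For a face containing the apex, its coefficient in \<open>z\<close> is
      recovered from the vanishing of \<open>bd z\<close> at \<open>\<tau> - {a}\<close>.\<close>
    define s where "s = (\<Sum>v\<in>\<Union>X - \<tau>. z (insert v (\<tau> - {a})))"
    have split: "\<Union>X - (\<tau> - {a}) = insert a (\<Union>X - \<tau>)"
      using a by auto
    have "bd z (\<tau> - {a}) = z \<tau> + s"
      unfolding eq[OF z(1)] split s_def using fin True by (subst sum.insert) (auto simp: insert_absorb)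
    then have "z \<tau> = s"
      using z(2) by (cases "z \<tau>"; cases s) auto
    moreover have "bd y \<tau> = s"
      unfolding eq[OF y] s_def using True by (intro sum.cong) (auto simp: y_def insert_Diff_if)
    ultimately show ?thesis
      by simp
  qed
  then show "\<exists>y. chain_on X y \<and> bd y = z"
    using y by (intro exI[of _ y]) auto
qed

lemma mod2_acyclic_Pow:
  assumes "finite W" "W \<noteq> {}"
  shows "mod2_acyclic (Pow W)"
proof -
  obtain a where "a \<in> W"
    using assms by auto
  then show ?thesis
    using assms by (intro mod2_acyclic_cone[of _ a] simplicial_complex_Pow) auto
qed

text \<open>For disjoint \<alpha> and \<beta> with union \<open>W\<close> this is the join of the
  full simplex on \<alpha> with \<partial>\<beta>; for \<beta> equal to \<open>W\<close> it is the
  boundary of the simplex. Links are again of this form, with \<sigma> removed from both sets, so no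
  face has to be split along a join.\<close>

definition faces_avoiding :: "'a set \<Rightarrow> 'a set \<Rightarrow> 'a complex" where
  "faces_avoiding W \<beta> = {\<sigma>. \<sigma> \<subseteq> W \<and> \<not> \<beta> \<subseteq> \<sigma>}"

lemma join_full_simplex_boundary:
  assumes "\<alpha> \<inter> \<beta> = {}"
  shows "join (full_simplex \<alpha>) (boundary_complex \<beta>) = faces_avoiding (\<alpha> \<union> \<beta>) \<beta>"
proof (intro equalityI subsetI)
  fix \<sigma> assume "\<sigma> \<in> faces_avoiding (\<alpha> \<union> \<beta>) \<beta>"
  then have "\<sigma> = (\<sigma> \<inter> \<alpha>) \<union> (\<sigma> \<inter> \<beta>)" "\<sigma> \<inter> \<alpha> \<subseteq> \<alpha>" "\<sigma> \<inter> \<beta> \<subset> \<beta>"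
    by (auto simp: faces_avoiding_def)
  then show "\<sigma> \<in> join (full_simplex \<alpha>) (boundary_complex \<beta>)"
    unfolding join_def full_simplex_def boundary_complex_def by blast
qed (use assms in \<open>auto simp: faces_avoiding_def join_def full_simplex_def boundary_complex_def\<close>)

lemma join_boundary_full_simplex:
  assumes "\<alpha> \<inter> \<beta> = {}"
  shows "join (boundary_complex \<alpha>) (full_simplex \<beta>) = faces_avoiding (\<alpha> \<union> \<beta>) \<alpha>"
proof -
  have "join (boundary_complex \<alpha>) (full_simplex \<beta>) = join (full_simplex \<beta>) (boundary_complex \<alpha>)"
    unfolding join_def by (auto simp: Un_commute)
  then show ?thesis
    using join_full_simplex_boundary[of \<beta> \<alpha>] assms by (simp add: Un_commute Int_commute)
qed

lemma boundary_complex_eq: "boundary_complex W = faces_avoiding W W"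
  by (auto simp: boundary_complex_def faces_avoiding_def)

lemma simplicial_complex_faces_avoiding:
  assumes "finite W" "\<beta> \<noteq> {}"
  shows "simplicial_complex (faces_avoiding W \<beta>)"
  using assms by (auto simp: simplicial_complex_def faces_avoiding_def intro: finite_subset)

text \<open>A cone whose apex is any vertex of \<open>W\<close> outside \<beta>.\<close>

lemma mod2_acyclic_faces_avoiding:
  assumes "finite W" "\<beta> \<noteq> {}" "\<not> W \<subseteq> \<beta>"
  shows "mod2_acyclic (faces_avoiding W \<beta>)"
proof -
  obtain a where "a \<in> W" "a \<notin> \<beta>"
    using assms by auto
  then show ?thesis
    using assms
    by (intro mod2_acyclic_cone[of _ a] simplicial_complex_faces_avoiding) (auto simp: faces_avoiding_def)
qed

lemma card_faces_avoiding:
  assumes "finite W" "\<beta> \<subseteq> W" "\<sigma> \<in> faces_avoiding W \<beta>"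
  shows "card \<sigma> < card W"
  using assms by (intro psubset_card_mono) (auto simp: faces_avoiding_def)

lemma bd_faces_chain_Pow:
  assumes "finite W" "W \<noteq> {}"
  shows "bd (faces_chain (card W) (Pow W)) = faces_chain (card W - 1) (boundary_complex W)"
proof
  fix \<tau>
  let ?c = "faces_chain (card W) (Pow W)"
  have c: "?c \<sigma> = of_bool (\<sigma> = W)" for \<sigma>
    using assms(1) card_subset_eq[of W \<sigma>] by (auto simp: faces_chain_def)
  have eq: "bd ?c \<tau> = (\<Sum>v\<in>W - \<tau>. ?c (insert v \<tau>))"
    by (rule bd_eq_sum[OF assms(1) _ chain_on_faces_chain]) auto
  show "bd ?c \<tau> = faces_chain (card W - 1) (boundary_complex W) \<tau>"
  proof (cases "\<tau> \<subset> W \<and> card \<tau> = card W - 1")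
    case True
    then have "card (W - \<tau>) = 1"
      using assms by (subst card_Diff_subset) (auto simp: card_gt_0_iff Suc_le_eq intro: finite_subset)
    then obtain x where x: "W - \<tau> = {x}"
      by (auto simp: card_1_singleton_iff)
    then have "insert x \<tau> = W"
      using True by auto
    then have "bd ?c \<tau> = 1"
      by (simp add: eq x c)
    then show ?thesis
      using True by (simp add: faces_chain_def boundary_complex_def)
  next
    case False
    have "bd ?c \<tau> = 0"
    proof (rule ccontr)
      assume "bd ?c \<tau> \<noteq> 0"
      then obtain v where "v \<notin> \<tau>" "?c (insert v \<tau>) \<noteq> 0"
        by (rule bd_nonzeroE)
      then have "insert v \<tau> = W"
        by (simp add: c split: if_splits)
      then show False
        using False \<open>v \<notin> \<tau>\<close> assms(1) by auto
    qed
    then show ?thesis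
      using False by (auto simp: faces_chain_def boundary_complex_def)
  qed
qed

text \<open>The full simplex is acyclic and differs from its boundary by the single face
  \<open>W\<close>. As no boundary has a coefficient at \<open>W\<close>, the coefficient of a
  filling there decides whether it can stay inside the boundary complex.\<close>

lemma strong_sphere_boundary_complex:
  fixes W :: "'a::linorder set"
  assumes W: "finite W" "W \<noteq> {}"
  shows "strong_sphere (card W - 1) (boundary_complex W)"
proof -
  let ?\<delta> = "faces_chain (card W) (Pow W)" and ?f = "faces_chain (card W - 1) (boundary_complex W)"
  note cP = simplicial_complex_Pow[OF W(1)]
  note bd\<delta> = bd_faces_chain_Pow[OF W] and \<delta> = chain_on_faces_chain[of "Pow W" "card W"]
  have \<delta>W: "?\<delta> W = 1"
    by (simp add: faces_chain_def)
  have mono: "chain_on (Pow W) y" if "chain_on (boundary_complex W) y" for y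
    using that by (auto simp: chain_on_def boundary_complex_def)
  have iff: "chain_on (boundary_complex W) y \<longleftrightarrow> y W = 0" if "chain_on (Pow W) y" for y
    using that by (auto simp: chain_on_def boundary_complex_def)
  have no_bd: "bd y W = 0" if "chain_on (Pow W) y" for y
  proof (rule ccontr)
    assume "bd y W \<noteq> 0"
    then obtain v where "v \<notin> W" "y (insert v W) \<noteq> 0"
      by (rule bd_nonzeroE)
    then show False
      using that by (auto simp: chain_on_def)
  qed
  have "generated_by_cycle (boundary_complex W) ?f"
    unfolding generated_by_cycle_def
  proof (intro conjI allI impI notI)
    show "bd ?f = 0"
      using bd_bd[OF cP \<delta>] by (simp add: bd\<delta>)
  next
    assume "\<exists>y. chain_on (boundary_complex W) y \<and> bd y = ?f"
    then obtain y where y: "chain_on (boundary_complex W) y" "bd y = ?f"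
      by blast
    \<comment> \<open>The sum would be a cycle of the simplex, hence a boundary, although its
      coefficient at \<open>W\<close> is 1.\<close>
    have "bd (y + ?\<delta>) = 0"
      using bd_add[OF cP mono[OF y(1)] \<delta>] y by (simp add: bd\<delta>)
    then obtain u where "chain_on (Pow W) u" "bd u = y + ?\<delta>"
      using mod2_acyclicD[OF mod2_acyclic_Pow[OF W]] chain_on_add[OF mono[OF y(1)] \<delta>] by metis
    then have "(y + ?\<delta>) W = 0"
      using no_bd by metis
    moreover have "y W = 0"
      using y by (auto simp: chain_on_def boundary_complex_def)
    ultimately show False
      using \<delta>W by simp
  next
    fix z assume z: "chain_on (boundary_complex W) z" "bd z = 0"
    obtain y where y: "chain_on (Pow W) y" "bd y = z"
      using mod2_acyclicD[OF mod2_acyclic_Pow[OF W] mono[OF z(1)] z(2)] .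
    show "\<exists>y. chain_on (boundary_complex W) y \<and> (z = bd y \<or> z = bd y + ?f)"
    proof (cases "y W = 0")
      case True
      then show ?thesis
        using y iff by blast
    next
      case False
      then have "chain_on (boundary_complex W) (y + ?\<delta>)"
        using iff[OF chain_on_add[OF y(1) \<delta>]] \<delta>W by simp
      moreover have "z = bd (y + ?\<delta>) + ?f"
        using bd_add[OF cP y(1) \<delta>] y by (simp add: bd\<delta> add.assoc)
      ultimately show ?thesis
        by blast
    qed
  qed (rule chain_on_faces_chain)
  moreover have "card \<sigma> \<le> card W - 1" if "\<sigma> \<in> boundary_complex W" for \<sigma>
    using psubset_card_mono[OF W(1), of \<sigma>] that by (auto simp: boundary_complex_def)
  ultimately show ?thesis
    by (simp add: strong_sphere_def)
qed

text \<open>A face \<tau> with \<open>n\<close> vertices misses two vertices \<open>x\<close>,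
  \<open>y\<close> of \<open>W\<close>, and \<open>insert x \<tau>\<close> lies in the ball exactly
  if \<open>y\<close> is in \<beta>. So modulo 2 the coefficient is 1 exactly if one of the two is
  in \<beta> and the other is not, that is, if \<tau> contains neither \<beta> nor its
  complement.\<close>

lemma bd_faces_chain_faces_avoiding:
  assumes "finite W" "\<beta> \<subseteq> W" "card W = Suc (Suc n)"
  shows "bd (faces_chain (Suc n) (faces_avoiding W \<beta>)) =
    faces_chain n (faces_avoiding W (W - \<beta>) \<inter> faces_avoiding W \<beta>)" (is "bd ?c = ?d")
proof
  fix \<tau>
  have eq: "bd ?c \<tau> = (\<Sum>v\<in>W - \<tau>. ?c (insert v \<tau>))"
    by (rule bd_eq_sum[OF assms(1) _ chain_on_faces_chain]) (auto simp: faces_avoiding_def)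
  show "bd ?c \<tau> = ?d \<tau>"
  proof (cases "\<tau> \<subseteq> W \<and> card \<tau> = n")
    case True
    then have fin: "finite \<tau>"
      using assms(1) finite_subset by blast
    then have "card (W - \<tau>) = 2"
      using True assms by (subst card_Diff_subset) auto
    then obtain x y where xy: "W - \<tau> = {x, y}" "x \<noteq> y"
      by (auto simp: card_2_iff)
    then have mem: "x \<notin> \<tau>" "y \<notin> \<tau>" "x \<in> W" "y \<in> W" and W: "W = insert x (insert y \<tau>)"
      using True by blast+
    have iff: "\<beta> \<subseteq> insert x \<tau> \<longleftrightarrow> y \<notin> \<beta>" "\<beta> \<subseteq> insert y \<tau> \<longleftrightarrow> x \<notin> \<beta>"
      "\<beta> \<subseteq> \<tau> \<longleftrightarrow> x \<notin> \<beta> \<and> y \<notin> \<beta>" "W - \<beta> \<subseteq> \<tau> \<longleftrightarrow> x \<in> \<beta> \<and> y \<in> \<beta>"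
      using assms(2) mem W \<open>x \<noteq> y\<close> by blast+
    have c: "?c (insert x \<tau>) = of_bool (y \<in> \<beta>)" "?c (insert y \<tau>) = of_bool (x \<in> \<beta>)"
      using True fin mem by (simp_all add: faces_chain_def faces_avoiding_def iff)
    have "?d \<tau> = of_bool ((x \<notin> \<beta> \<or> y \<notin> \<beta>) \<and> (x \<in> \<beta> \<or> y \<in> \<beta>))"
      using True by (auto simp: faces_chain_def faces_avoiding_def iff)
    moreover have "bd ?c \<tau> = ?c (insert x \<tau>) + ?c (insert y \<tau>)"
      using xy(2) unfolding eq xy(1) by simp
    ultimately show ?thesis
      unfolding c by auto
  next
    case False
    have "bd ?c \<tau> = 0"
    proof (rule ccontr)
      assume "bd ?c \<tau> \<noteq> 0"
      then obtain v where v: "v \<notin> \<tau>" "?c (insert v \<tau>) \<noteq> 0"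
        by (rule bd_nonzeroE)
      then have "insert v \<tau> \<subseteq> W" "card (insert v \<tau>) = Suc n"
        by (simp_all add: faces_chain_def faces_avoiding_def split: if_splits)
      moreover from this have "finite \<tau>"
        using assms(1) finite_subset by auto
      ultimately show False
        using False v by simp
    qed
    then show ?thesis
      using False by (auto simp: faces_chain_def faces_avoiding_def)
  qed
qed

lemma card_faces_avoiding_Int:
  assumes "finite W" "\<alpha> \<union> \<beta> = W" "\<alpha> \<inter> \<beta> = {}" "\<sigma> \<in> faces_avoiding W \<alpha> \<inter> faces_avoiding W \<beta>"
  shows "card \<sigma> + 2 \<le> card W"
proof -
  obtain a b where ab: "a \<in> \<alpha>" "a \<notin> \<sigma>" "b \<in> \<beta>" "b \<notin> \<sigma>" "\<sigma> \<subseteq> W"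
    using assms(4) by (auto simp: faces_avoiding_def)
  then have "a \<noteq> b" "finite \<sigma>" "insert a (insert b \<sigma>) \<subseteq> W"
    using assms(2,3) finite_subset[OF _ assms(1)] by blast+
  then show ?thesis
    using card_mono[OF assms(1), of "insert a (insert b \<sigma>)"] ab by simp
qed

text \<open>The two joins share out the boundary of the simplex on \<open>W\<close>, which is a
  sphere, so their intersection \<partial>\<alpha> * \<partial>\<beta> is a sphere too. The
  dimension \<open>n\<close> of the balls is two less than the number of vertices of
  \<open>W\<close>.\<close>

lemma ball_pair_faces_avoiding:
  fixes \<alpha> \<beta> :: "'a::linorder set"
  assumes W: "finite W" "\<alpha> \<union> \<beta> = W" and dis: "\<alpha> \<inter> \<beta> = {}" and ne: "\<alpha> \<noteq> {}" "\<beta> \<noteq> {}"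
    and n: "card W = Suc (Suc n)"
  shows "ball_pair n (faces_avoiding W \<beta>) (faces_avoiding W \<alpha> \<inter> faces_avoiding W \<beta>)"
proof -
  have compl: "W - \<beta> = \<alpha>" "W - \<alpha> = \<beta>" and sub: "\<alpha> \<subseteq> W" "\<beta> \<subseteq> W"
    using W dis by auto
  let ?A = "faces_avoiding W \<alpha>" and ?B = "faces_avoiding W \<beta>"
  have cA: "simplicial_complex ?A" and cB: "simplicial_complex ?B"
    using simplicial_complex_faces_avoiding[OF W(1)] ne by auto
  have acA: "mod2_acyclic ?A" and acB: "mod2_acyclic ?B"
    using W dis ne by (auto intro!: mod2_acyclic_faces_avoiding)
  have bdA: "bd (faces_chain (Suc n) ?A) = faces_chain n (?A \<inter> ?B)"
    using bd_faces_chain_faces_avoiding[OF W(1) sub(1) n] by (simp add: compl Int_commute)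
  have bdB: "bd (faces_chain (Suc n) ?B) = faces_chain n (?A \<inter> ?B)"
    using bd_faces_chain_faces_avoiding[OF W(1) sub(2) n] by (simp add: compl)
  have small: "card \<sigma> \<le> n" if "\<sigma> \<in> ?A \<inter> ?B" for \<sigma>
    using card_faces_avoiding_Int[OF W dis that] n by simp
  have "strong_sphere (Suc n) (boundary_complex W)"
    using strong_sphere_boundary_complex[OF W(1)] W ne n by auto
  moreover have "boundary_complex W = ?A \<union> ?B"
    using W by (auto simp: boundary_complex_def faces_avoiding_def)
  ultimately have "generated_by_cycle (?A \<union> ?B) (faces_chain (Suc n) (?A \<union> ?B))"
    by (simp add: strong_sphere_def)
  moreover have "faces_chain (Suc n) (?A \<union> ?B) = faces_chain (Suc n) ?A + faces_chain (Suc n) ?B"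
    using small by (intro faces_chain_Un) force
  ultimately have "generated_by_cycle (?A \<inter> ?B) (bd (faces_chain (Suc n) ?A))"
    by (intro generated_by_cycle_Int[OF cA cB acA acB]) (auto simp: chain_on_faces_chain)
  then have "strong_sphere n (?A \<inter> ?B)"
    using small by (simp add: bdA strong_sphere_def)
  then show ?thesis
    using acB bdB card_faces_avoiding[OF W(1) sub(2)] n by (auto simp: ball_pair_def less_Suc_eq_le)
qed


section \<open>Links\<close>

lemma link_Un: "link (A \<union> B) \<sigma> = link A \<sigma> \<union> link B \<sigma>"
  by (auto simp: link_def)

lemma link_Int: "link (A \<inter> B) \<sigma> = link A \<sigma> \<inter> link B \<sigma>"
  by (auto simp: link_def)

lemma simplicial_complex_link:
  assumes X: "simplicial_complex X" and "\<sigma> \<in> X"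
  shows "simplicial_complex (link X \<sigma>)"
proof -
  have sub: "link X \<sigma> \<subseteq> X"
  proof
    fix \<tau> assume "\<tau> \<in> link X \<sigma>"
    then have "\<tau> \<union> \<sigma> \<in> X"
      by (simp add: link_def)
    then show "\<tau> \<in> X"
      by (rule face_subset[OF X]) simp
  qed
  have "finite X"
    using X by (simp add: simplicial_complex_def)
  then have "finite (link X \<sigma>)"
    by (rule finite_subset[OF sub])
  moreover have "\<forall>\<tau>\<in>link X \<sigma>. finite \<tau>"
    using sub face_finite[OF X] by blast
  moreover have "\<forall>\<tau>\<in>link X \<sigma>. \<forall>\<rho>. \<rho> \<subseteq> \<tau> \<longrightarrow> \<rho> \<in> link X \<sigma>"
  proof (intro ballI allI impI)
    fix \<tau> \<rho> assume "\<tau> \<in> link X \<sigma>" "\<rho> \<subseteq> \<tau>"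
    then have "\<tau> \<union> \<sigma> \<in> X" "\<rho> \<union> \<sigma> \<subseteq> \<tau> \<union> \<sigma>" "\<rho> \<inter> \<sigma> = {}"
      by (auto simp: link_def)
    then show "\<rho> \<in> link X \<sigma>"
      using face_subset[OF X, of "\<tau> \<union> \<sigma>" "\<rho> \<union> \<sigma>"] by (simp add: link_def)
  qed
  moreover have "{} \<in> link X \<sigma>"
    using assms(2) by (simp add: link_def)
  ultimately show ?thesis
    by (simp add: simplicial_complex_def)
qed

lemma link_empty: "link X {} = X"
  by (simp add: link_def)

lemma link_Pow: "\<sigma> \<subseteq> W \<Longrightarrow> link (Pow W) \<sigma> = Pow (W - \<sigma>)"
  by (auto simp: link_def)

lemma link_faces_avoiding:
  "\<sigma> \<subseteq> W \<Longrightarrow> link (faces_avoiding W \<beta>) \<sigma> = faces_avoiding (W - \<sigma>) (\<beta> - \<sigma>)"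
  by (auto simp: link_def faces_avoiding_def)

lemma link_eq_empty: "simplicial_complex X \<Longrightarrow> \<sigma> \<notin> X \<Longrightarrow> link X \<sigma> = {}"
  by (auto simp: link_def simplicial_complex_def)

section \<open>Degree parts of chains, and facets of spheres\<close>

text \<open>Faces are finite, so the boundary lowers the number of vertices by one; this is how
  degrees are recovered from ungraded chains.\<close>

lemma bd_restrict_card:
  assumes X: "simplicial_complex X" and y: "chain_on X y"
  shows "bd (restrict_chain y {\<sigma>. card \<sigma> = Suc n}) = restrict_chain (bd y) {\<sigma>. card \<sigma> = n}"
proof
  fix \<tau>
  let ?y = "restrict_chain y {\<sigma>. card \<sigma> = Suc n}"
  have y': "chain_on X ?y"
    using y by (auto simp: chain_on_def restrict_chain_def)
  note eq = bd_eq_sum[OF finite_Union_complex[OF X] subset_refl]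
  have coeff: "?y (insert v \<tau>) = (if card \<tau> = n then y (insert v \<tau>) else 0)" if "v \<notin> \<tau>" for v
  proof (cases "insert v \<tau> \<in> X")
    case True
    then have "finite \<tau>"
      using face_finite[OF X] by fastforce
    then show ?thesis
      using that by (simp add: restrict_chain_def)
  next
    case False
    then show ?thesis
      using y by (simp add: restrict_chain_def chain_on_def)
  qed
  show "bd ?y \<tau> = restrict_chain (bd y) {\<sigma>. card \<sigma> = n} \<tau>"
    unfolding eq[OF y'] restrict_chain_def[of "bd y"] eq[OF y] using coeff by simp
qed

text \<open>Makes the generating cycle of a new interior link homogeneous, as
  \<open>weak_sphere\<close> asks.\<close>

lemma graded_bounding_chain:
  assumes X: "simplicial_complex X" and y: "chain_on X y" "bd y = s"
    and s: "\<And>\<sigma>. s \<sigma> \<noteq> 0 \<Longrightarrow> card \<sigma> = n"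
  obtains y' where "chain_on X y'" "bd y' = s" "\<And>\<sigma>. y' \<sigma> \<noteq> 0 \<Longrightarrow> card \<sigma> = Suc n"
proof
  let ?y = "restrict_chain y {\<sigma>. card \<sigma> = Suc n}"
  show "chain_on X ?y"
    using y(1) by (auto simp: chain_on_def restrict_chain_def)
  show "bd ?y = s"
    unfolding bd_restrict_card[OF X y(1)] y(2) using s by (fastforce simp: restrict_chain_def)
  show "card \<sigma> = Suc n" if "?y \<sigma> \<noteq> 0" for \<sigma>
    using that by (auto simp: restrict_chain_def split: if_splits)
qed

lemma bd_facet_eq_0:
  assumes X: "simplicial_complex X" and "\<forall>\<sigma>\<in>X. card \<sigma> \<le> n" and y: "chain_on X y" and "card \<phi> = n" "finite \<phi>"
  shows "bd y \<phi> = 0"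
proof (rule ccontr)
  assume "bd y \<phi> \<noteq> 0"
  then obtain v where "v \<notin> \<phi>" "insert v \<phi> \<in> X"
    using y unfolding chain_on_def by (metis bd_nonzeroE)
  then show False
    using assms by fastforce
qed

lemma strong_sphere_facet:
  assumes "strong_sphere n X"
  obtains \<phi> where "\<phi> \<in> X" "card \<phi> = n"
proof -
  have "faces_chain n X \<noteq> 0"
    using assms unfolding strong_sphere_def generated_by_cycle_def by (metis bd_0 chain_on_0)
  then show ?thesis
    using that by (auto simp: faces_chain_def fun_eq_iff)
qed

text \<open>Boundaries vanish on facets, so the cycle of \<open>S\<close>, which does not vanish
  there, must agree with the fundamental cycle of \<open>L\<close> on every facet of
  \<open>L\<close>.\<close>

lemma strong_subsphere_facets:
  assumes L: "simplicial_complex L" "strong_sphere n L" and S: "strong_sphere n S" "S \<subseteq> L"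
    and \<phi>: "\<phi> \<in> L" "card \<phi> = n"
  shows "\<phi> \<in> S"
proof -
  have S_cycle: "chain_on L (faces_chain n S)" "bd (faces_chain n S) = 0"
    using S chain_on_mono[OF chain_on_faces_chain] by (auto simp: strong_sphere_def generated_by_cycle_def)
  obtain y where y: "chain_on L y"
    "faces_chain n S = bd y \<or> faces_chain n S = bd y + faces_chain n L"
    using generated_by_cycleD[OF _ S_cycle] L(2) unfolding strong_sphere_def by metis
  have zero: "bd y \<psi> = 0" if "\<psi> \<in> L" "card \<psi> = n" for \<psi>
    using bd_facet_eq_0[OF L(1) _ y(1) that(2) face_finite[OF L(1) that(1)]] L(2)
    by (simp add: strong_sphere_def)
  obtain \<psi> where \<psi>: "\<psi> \<in> S" "card \<psi> = n"
    using strong_sphere_facet[OF S(1)] .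
  have "faces_chain n S \<psi> = 1"
    using \<psi> by (simp add: faces_chain_def)
  then have "faces_chain n S \<noteq> bd y"
    using zero \<psi> S(2) by (metis subsetD zero_neq_one)
  then have "faces_chain n S \<phi> = bd y \<phi> + faces_chain n L \<phi>"
    using y(2) by (metis plus_fun_apply)
  then show ?thesis
    using zero[OF \<phi>] \<phi> by (simp add: faces_chain_def split: if_splits)
qed


section \<open>Stacked fillings of stellated spheres\<close>

text \<open>\<open>N\<close> is the number of vertices of a facet of the ball, whose dimension is
  thus \<open>N - 1\<close>. At the empty face the clauses on links say that \<open>B\<close> is
  acyclic and \<open>X\<close> a sphere. The last clause is stackedness: codimension at least
  \<open>k + 1\<close> in \<open>B\<close> means \<open>card \<sigma> + k < N\<close>. The bound
  \<open>card \<sigma> < N\<close> makes \<open>N - 1 - card \<sigma>\<close> a true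
  difference.\<close>

definition stacked_filling :: "nat \<Rightarrow> nat \<Rightarrow> 'a complex \<Rightarrow> 'a complex \<Rightarrow> bool" where
  "stacked_filling k N X B \<longleftrightarrow>
     simplicial_complex X \<and> simplicial_complex B \<and> X \<subseteq> B \<and>
     (\<forall>\<sigma>\<in>B. card \<sigma> \<le> N) \<and> (\<exists>\<sigma>\<in>B. card \<sigma> = N) \<and>
     (\<forall>\<sigma>\<in>B - X. weak_sphere (N - card \<sigma>) (link B \<sigma>)) \<and>
     (\<forall>\<sigma>\<in>X. mod2_acyclic (link B \<sigma>)) \<and>
     (\<forall>\<sigma>\<in>X. card \<sigma> < N \<and> strong_sphere (N - 1 - card \<sigma>) (link X \<sigma>)) \<and>
     (\<forall>\<sigma>\<in>B. card \<sigma> + k < N \<longrightarrow> \<sigma> \<in> X)"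

text \<open>The (-1)-sphere, as the boundary of a point; it is the link of a facet.\<close>

lemma weak_sphere_empty_face: "weak_sphere 0 {{} :: 'a::linorder set}"
proof -
  have "boundary_complex {undefined} = {{} :: 'a set}"
    by (auto simp: boundary_complex_def)
  then show ?thesis
    using strong_sphere_boundary_complex[of "{undefined :: 'a}"] by (simp add: strong_sphere_imp_weak_sphere)
qed

text \<open>The only face outside the boundary is \<open>W\<close> itself, so the simplex is stacked
  for every \<open>k\<close>; the bound on \<open>k\<close> provides a non-empty
  \<open>W\<close>.\<close>

lemma stacked_filling_simplex:
  fixes W :: "'a::linorder set"
  assumes W: "finite W" "card W = N" "2 * k < N"
  shows "stacked_filling k N (boundary_complex W) (Pow W)"
proof -
  have ne: "W \<noteq> {}"
    using W by auto
  have mem: "\<sigma> \<in> boundary_complex W \<longleftrightarrow> \<sigma> \<subset> W" for \<sigma>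
    by (simp add: boundary_complex_def)
  have "strong_sphere (N - 1 - card \<sigma>) (link (boundary_complex W) \<sigma>)" if "\<sigma> \<subset> W" for \<sigma>
  proof -
    have "link (boundary_complex W) \<sigma> = boundary_complex (W - \<sigma>)"
      using that by (simp add: boundary_complex_eq link_faces_avoiding psubset_imp_subset)
    moreover have "card (W - \<sigma>) - 1 = N - 1 - card \<sigma>"
      using that W by (subst card_Diff_subset) (auto intro: finite_subset)
    ultimately show ?thesis
      using strong_sphere_boundary_complex[of "W - \<sigma>"] that W by auto
  qed
  moreover have "mod2_acyclic (link (Pow W) \<sigma>)" if "\<sigma> \<subset> W" for \<sigma>
    using that W by (auto simp: link_Pow psubset_imp_subset intro!: mod2_acyclic_Pow)
  moreover have "weak_sphere (N - card \<sigma>) (link (Pow W) \<sigma>)" if "\<sigma> \<in> Pow W - boundary_complex W" for \<sigma>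
  proof -
    have "\<sigma> = W"
      using that by (auto simp: boundary_complex_def)
    then show ?thesis
      using W weak_sphere_empty_face by (simp add: link_Pow)
  qed
  ultimately show ?thesis
    unfolding stacked_filling_def
    using W ne simplicial_complex_faces_avoiding[OF W(1) ne] simplicial_complex_Pow[OF W(1)]
      psubset_card_mono[OF W(1)] card_mono[OF W(1)]
    by (auto simp: mem boundary_complex_eq[symmetric])
qed

section \<open>Gluing a simplex onto the ball along a move\<close>

text \<open>A move of index less than \<open>k\<close>, counted in vertices: dimensions with sum
  \<open>N - 2\<close> become \<open>card \<alpha> + card \<beta> = N\<close>, and
  \<open>face_dim \<beta> < int k\<close> becomes \<open>card \<beta> \<le> k\<close>.\<close>

locale admissible_move =
  fixes k N :: nat and X B :: "'a::linorder complex" and \<alpha> \<beta> W :: "'a set"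
  assumes filling: "stacked_filling k N X B"
    and fin: "finite \<alpha>" "finite \<beta>" and ne: "\<alpha> \<noteq> {}" "\<beta> \<noteq> {}" and disjoint: "\<alpha> \<inter> \<beta> = {}"
    and card_sum: "card \<alpha> + card \<beta> = N" and index: "card \<beta> \<le> k" and k_small: "2 * k < N"
    and W: "W = \<alpha> \<union> \<beta>"
    and induced: "{\<sigma> \<in> X. \<sigma> \<subseteq> W} = faces_avoiding W \<beta>"
begin

lemma complexes: "simplicial_complex X" "simplicial_complex B"
  and sub: "X \<subseteq> B"
  and card_B: "\<And>\<sigma>. \<sigma> \<in> B \<Longrightarrow> card \<sigma> \<le> N"
  and interior: "\<And>\<sigma>. \<sigma> \<in> B \<Longrightarrow> \<sigma> \<notin> X \<Longrightarrow> weak_sphere (N - card \<sigma>) (link B \<sigma>)"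
  and boundary: "\<And>\<sigma>. \<sigma> \<in> X \<Longrightarrow> mod2_acyclic (link B \<sigma>)"
  and card_X: "\<And>\<sigma>. \<sigma> \<in> X \<Longrightarrow> card \<sigma> < N"
  and sphere: "\<And>\<sigma>. \<sigma> \<in> X \<Longrightarrow> strong_sphere (N - 1 - card \<sigma>) (link X \<sigma>)"
  and stacked: "\<And>\<sigma>. \<sigma> \<in> B \<Longrightarrow> card \<sigma> + k < N \<Longrightarrow> \<sigma> \<in> X"
  using filling unfolding stacked_filling_def by blast+

lemma finW: "finite W" and cardW: "card W = N"
  using fin disjoint card_sum by (simp_all add: W card_Un_disjoint)

lemma in_X_iff: "\<sigma> \<subseteq> W \<Longrightarrow> \<sigma> \<in> X \<longleftrightarrow> \<not> \<beta> \<subseteq> \<sigma>"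
  using induced by (auto simp: faces_avoiding_def)

text \<open>Stackedness of the old ball keeps \<open>\<beta>\<close> out of it, so that the new simplex is attached along
  \<open>\<alpha> * \<partial>\<beta>\<close> only.\<close>

lemma beta_not_in_B: "\<beta> \<notin> B"
  using stacked[of \<beta>] in_X_iff[of \<beta>] index k_small W by auto

lemma in_B_iff: "\<sigma> \<subseteq> W \<Longrightarrow> \<sigma> \<in> B \<longleftrightarrow> \<not> \<beta> \<subseteq> \<sigma>"
  using beta_not_in_B face_subset[OF complexes(2)] in_X_iff sub by blast

text \<open>The link of \<sigma> is a strong sphere and so has a facet of full size; in other words,
  \<open>X\<close> is pure.\<close>

lemma facet_superset:
  assumes "\<sigma> \<in> X"
  obtains \<phi> where "\<phi> \<in> X" "\<sigma> \<subseteq> \<phi>" "card \<phi> = N - 1"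
proof -
  obtain \<rho> where \<rho>: "\<rho> \<in> link X \<sigma>" "card \<rho> = N - 1 - card \<sigma>"
    using strong_sphere_facet[OF sphere[OF assms]] .
  then have "\<rho> \<union> \<sigma> \<in> X" "\<rho> \<inter> \<sigma> = {}"
    by (auto simp: link_def)
  moreover from this have "finite \<rho>" "finite \<sigma>"
    using face_finite[OF complexes(1)] by blast+
  ultimately show ?thesis
    using that[of "\<rho> \<union> \<sigma>"] \<rho>(2) card_X[OF assms] by (simp add: card_Un_disjoint)
qed

text \<open>The link of \<open>\<alpha>\<close> is a sphere that contains the sphere \<open>\<partial>\<beta>\<close> of the same dimension.\<close>

lemma star_alpha:
  assumes "\<sigma> \<in> X" "\<alpha> \<subseteq> \<sigma>"
  shows "\<sigma> \<subseteq> W"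
proof -
  obtain \<phi> where \<phi>: "\<phi> \<in> X" "\<sigma> \<subseteq> \<phi>" "card \<phi> = N - 1"
    using facet_superset[OF assms(1)] .
  have \<alpha>: "\<alpha> \<in> X"
    using assms face_subset[OF complexes(1)] by blast
  have eq: "N - 1 - card \<alpha> = card \<beta> - 1"
    using card_sum by simp
  have S: "strong_sphere (card \<beta> - 1) (boundary_complex \<beta>)"
    using strong_sphere_boundary_complex fin ne by blast
  have "boundary_complex \<beta> \<subseteq> link X \<alpha>"
  proof
    fix \<tau> assume "\<tau> \<in> boundary_complex \<beta>"
    then have "\<tau> \<union> \<alpha> \<subseteq> W" "\<not> \<beta> \<subseteq> \<tau> \<union> \<alpha>" "\<tau> \<inter> \<alpha> = {}"
      using disjoint by (auto simp: boundary_complex_def W)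
    then show "\<tau> \<in> link X \<alpha>"
      using in_X_iff by (simp add: link_def)
  qed
  moreover have "\<phi> - \<alpha> \<in> link X \<alpha>"
    using \<phi>(1,2) assms(2) by (auto simp: link_def Un_absorb2)
  moreover have "card (\<phi> - \<alpha>) = card \<beta> - 1"
    using \<phi> assms(2) fin eq by (subst card_Diff_subset) auto
  ultimately have "\<phi> - \<alpha> \<in> boundary_complex \<beta>"
    using strong_subsphere_facets[OF simplicial_complex_link[OF complexes(1) \<alpha>]]
      sphere[OF \<alpha>] S unfolding eq by blast
  then show ?thesis
    using \<phi>(2) by (auto simp: boundary_complex_def W)
qed

text \<open>Removing all of \<alpha> * \<partial>\<beta>, as the move prescribes, leaves no complex.
  Removing only the open star of \<alpha> does, and it keeps \<partial>\<alpha> * \<partial>\<beta>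
  as a seam, so that the old and the new sphere both arise from \<open>rest\<close> by gluing in a
  ball.\<close>

definition rest :: "'a complex" where
  "rest = {\<sigma> \<in> X. \<not> \<alpha> \<subseteq> \<sigma>}"

definition new_sphere :: "'a complex" where
  "new_sphere = (X - faces_avoiding W \<beta>) \<union> faces_avoiding W \<alpha>"

definition new_ball :: "'a complex" where
  "new_ball = B \<union> Pow W"

lemma complex_rest: "simplicial_complex rest"
  using complexes(1) ne by (auto simp: simplicial_complex_def rest_def)

text \<open>This is where the star of \<alpha> matters: a face containing \<alpha> lies in
  \<open>W\<close> and so belongs to the ball that is cut out.\<close>

lemma old_sphere_eq: "X = rest \<union> faces_avoiding W \<beta>"
proof (rule Set.set_eqI)
  show "\<sigma> \<in> X \<longleftrightarrow> \<sigma> \<in> rest \<union> faces_avoiding W \<beta>" for \<sigma>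
    using star_alpha[of \<sigma>] in_X_iff[of \<sigma>] by (auto simp: rest_def faces_avoiding_def)
qed

lemma new_sphere_eq: "new_sphere = rest \<union> faces_avoiding W \<alpha>"
proof (rule Set.set_eqI)
  show "\<sigma> \<in> new_sphere \<longleftrightarrow> \<sigma> \<in> rest \<union> faces_avoiding W \<alpha>" for \<sigma>
    using star_alpha[of \<sigma>] in_X_iff[of \<sigma>] by (auto simp: rest_def new_sphere_def faces_avoiding_def)
qed

lemma rest_Int:
  "rest \<inter> faces_avoiding W \<beta> = faces_avoiding W \<alpha> \<inter> faces_avoiding W \<beta>"
  "rest \<inter> faces_avoiding W \<alpha> = faces_avoiding W \<beta> \<inter> faces_avoiding W \<alpha>"
  using in_X_iff by (auto simp: rest_def faces_avoiding_def)

lemma complex_new_sphere: "simplicial_complex new_sphere"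
  unfolding new_sphere_eq using complex_rest simplicial_complex_faces_avoiding finW ne
  by (intro simplicial_complex_Un) auto

lemma complex_new_ball: "simplicial_complex new_ball"
  unfolding new_ball_def using complexes finW by (intro simplicial_complex_Un simplicial_complex_Pow)

text \<open>A face containing \<sigma> is not contained in \<open>W\<close> either, so neither the
  move nor the gluing affects it.\<close>

lemma link_outside:
  assumes "\<not> \<sigma> \<subseteq> W"
  shows "link new_ball \<sigma> = link B \<sigma>" "link new_sphere \<sigma> = link X \<sigma>"
    "\<sigma> \<in> new_sphere \<longleftrightarrow> \<sigma> \<in> X" "\<sigma> \<in> new_ball \<longleftrightarrow> \<sigma> \<in> B"
  using assms by (auto simp: link_def new_ball_def new_sphere_def faces_avoiding_def)

lemma in_new_sphere_iff: "\<sigma> \<subseteq> W \<Longrightarrow> \<sigma> \<in> new_sphere \<longleftrightarrow> \<not> \<alpha> \<subseteq> \<sigma>"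
  using in_X_iff[of \<sigma>] by (auto simp: new_sphere_def faces_avoiding_def)

text \<open>Links commute with intersections, so the overlap is the link of \<sigma> in \<alpha> *
  \<partial>\<beta>; it is empty if \<sigma> contains \<beta>.\<close>

lemma link_new_ball_inside:
  assumes "\<sigma> \<subseteq> W"
  shows "link new_ball \<sigma> = link B \<sigma> \<union> Pow (W - \<sigma>)"
    and "link B \<sigma> \<inter> Pow (W - \<sigma>) = faces_avoiding (W - \<sigma>) (\<beta> - \<sigma>)"
proof -
  show "link new_ball \<sigma> = link B \<sigma> \<union> Pow (W - \<sigma>)"
    using assms by (simp add: new_ball_def link_Un link_Pow)
  have "B \<inter> Pow W = faces_avoiding W \<beta>"
    using in_B_iff by (auto simp: faces_avoiding_def)
  then show "link B \<sigma> \<inter> Pow (W - \<sigma>) = faces_avoiding (W - \<sigma>) (\<beta> - \<sigma>)"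
    using assms by (metis link_Int link_Pow link_faces_avoiding)
qed

lemma card_W_minus: "\<sigma> \<subseteq> W \<Longrightarrow> card (W - \<sigma>) = N - card \<sigma>"
  using finW cardW by (subst card_Diff_subset) (auto intro: finite_subset)

text \<open>Inside \<open>W\<close>: if \<sigma> contains \<beta>, it is a new face whose link is a
  simplex. Otherwise two acyclic complexes are glued along a cone whose apex is a vertex of \<alpha>
  outside \<sigma>.\<close>

lemma new_ball_boundary:
  assumes "\<sigma> \<in> new_sphere"
  shows "mod2_acyclic (link new_ball \<sigma>)"
proof (cases "\<sigma> \<subseteq> W")
  case False
  then show ?thesis
    using assms boundary by (simp add: link_outside)
next
  case True
  then have \<alpha>: "\<not> \<alpha> \<subseteq> \<sigma>"
    using assms in_new_sphere_iff by blast
  then have P: "mod2_acyclic (Pow (W - \<sigma>))"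
    using finW W by (intro mod2_acyclic_Pow) auto
  show ?thesis
  proof (cases "\<beta> \<subseteq> \<sigma>")
    case False
    then have \<sigma>: "\<sigma> \<in> X" "\<sigma> \<in> B"
      using True in_X_iff in_B_iff by blast+
    have "\<not> W - \<sigma> \<subseteq> \<beta> - \<sigma>"
      using \<alpha> W disjoint by auto
    then have "mod2_acyclic (link B \<sigma> \<inter> Pow (W - \<sigma>))"
      unfolding link_new_ball_inside(2)[OF True]
      using finW False by (intro mod2_acyclic_faces_avoiding) auto
    then show ?thesis
      unfolding link_new_ball_inside(1)[OF True]
      using P boundary[OF \<sigma>(1)] finW simplicial_complex_link[OF complexes(2) \<sigma>(2)]
      by (intro mod2_acyclic_Un simplicial_complex_Pow) auto
  next
    case True
    then have "\<sigma> \<notin> B"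
      using \<open>\<sigma> \<subseteq> W\<close> in_B_iff by blast
    then show ?thesis
      using P by (simp add: link_new_ball_inside(1)[OF \<open>\<sigma> \<subseteq> W\<close>] link_eq_empty[OF complexes(2)])
  qed
qed

text \<open>A former boundary face containing \<alpha> has an acyclic link, and the simplex attached
  along its whole boundary closes this link to a sphere. The filling of that boundary inside the old
  link is only known to exist, not to be a sum of all facets, hence
  \<open>weak_sphere\<close>.\<close>

lemma new_ball_interior:
  assumes "\<sigma> \<in> new_ball" "\<sigma> \<notin> new_sphere"
  shows "weak_sphere (N - card \<sigma>) (link new_ball \<sigma>)"
proof (cases "\<sigma> \<subseteq> W")
  case False
  then show ?thesis
    using assms interior by (simp add: link_outside)
next
  case True
  then have \<alpha>: "\<alpha> \<subseteq> \<sigma>"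
    using assms in_new_sphere_iff by blast
  show ?thesis
  proof (cases "\<beta> \<subseteq> \<sigma>")
    case True
    then have "\<sigma> = W" "\<sigma> \<notin> B"
      using \<open>\<sigma> \<subseteq> W\<close> in_B_iff \<alpha> by (auto simp: W)
    then show ?thesis
      using link_new_ball_inside(1)[of \<sigma>] link_eq_empty[OF complexes(2)] weak_sphere_empty_face cardW by simp
  next
    case False
    then have \<sigma>: "\<sigma> \<in> X" "\<sigma> \<in> B"
      using True in_X_iff in_B_iff by blast+
    define V where "V = W - \<sigma>"
    have V: "finite V" "V \<noteq> {}" "card V = N - card \<sigma>" "\<beta> - \<sigma> = V"
      using finW False card_W_minus[OF True] \<alpha> by (auto simp: V_def W)
    have Int: "Pow V \<inter> link B \<sigma> = boundary_complex V"
      using link_new_ball_inside(2)[OF True] V by (simp add: V_def boundary_complex_eq Int_commute)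
    note cB = simplicial_complex_link[OF complexes(2) \<sigma>(2)]
    let ?s = "faces_chain (card V - 1) (boundary_complex V)"
    have s: "generated_by_cycle (boundary_complex V) ?s"
      using strong_sphere_boundary_complex[OF V(1,2)] by (simp add: strong_sphere_def)
    moreover have "boundary_complex V \<subseteq> link B \<sigma>"
      using Int by auto
    ultimately have "chain_on (link B \<sigma>) ?s" "bd ?s = 0"
      using chain_on_mono unfolding generated_by_cycle_def by blast+
    then obtain b0 where "chain_on (link B \<sigma>) b0" "bd b0 = ?s"
      using mod2_acyclicD[OF boundary[OF \<sigma>(1)]] by metis
    \<comment> \<open>The filling is cut down to the size of the facet \<open>V\<close>, which makes
      \<open>?f\<close> homogeneous; as \<open>V\<close> is not empty,
      \<open>Suc (card V - 1)\<close> is \<open>card V\<close>.\<close>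
    then obtain b where b: "chain_on (link B \<sigma>) b" "bd b = ?s"
      "\<And>\<tau>. b \<tau> \<noteq> 0 \<Longrightarrow> card \<tau> = Suc (card V - 1)"
      by (rule graded_bounding_chain[OF cB, where n = "card V - 1"]) (auto simp: faces_chain_def)
    let ?f = "faces_chain (card V) (Pow V) + b"
    have "generated_by_cycle (Pow V \<union> link B \<sigma>) ?f"
      using s b(1,2) boundary[OF \<sigma>(1)] bd_faces_chain_Pow[OF V(1,2)]
      by (intro generated_by_cycle_Un[where s = ?s])
        (auto simp: Int cB simplicial_complex_Pow mod2_acyclic_Pow V chain_on_faces_chain)
    moreover have "card \<tau> = card V" if "?f \<tau> \<noteq> 0" for \<tau>
    proof -
      have "faces_chain (card V) (Pow V) \<tau> \<noteq> 0 \<or> b \<tau> \<noteq> 0"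
        using that by auto
      then show ?thesis
        using b(3)[of \<tau>] V by (auto simp: faces_chain_def card_gt_0_iff)
    qed
    ultimately show ?thesis
      unfolding weak_sphere_def link_new_ball_inside(1)[OF True] V(3)[symmetric]
      by (metis Un_commute V_def)
  qed
qed

text \<open>For \<sigma> in \<open>W\<close> containing neither \<alpha> nor \<beta>, the link
  itself exchanges balls, with \<open>\<alpha> - \<sigma>\<close> and
  \<open>\<beta> - \<sigma>\<close>: the complement of one ball in the old link is a ball with the
  same boundary, and the other ball is glued to it.\<close>

lemma new_sphere_links:
  assumes "\<sigma> \<in> new_sphere"
  shows "card \<sigma> < N \<and> strong_sphere (N - 1 - card \<sigma>) (link new_sphere \<sigma>)"
proof (cases "\<sigma> \<subseteq> W")
  case False
  then show ?thesis
    using assms sphere card_X by (simp add: link_outside)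
next
  case True
  then have \<alpha>: "\<not> \<alpha> \<subseteq> \<sigma>"
    using assms in_new_sphere_iff by blast
  then have card: "card \<sigma> < N"
    using True psubset_card_mono[OF finW, of \<sigma>] cardW W by auto
  define V where "V = W - \<sigma>"
  have V: "finite V" "card V = N - card \<sigma>"
    using finW card_W_minus[OF True] by (auto simp: V_def)
  have "strong_sphere (N - 1 - card \<sigma>) (link new_sphere \<sigma>)"
  proof (cases "\<beta> \<subseteq> \<sigma>")
    case True
    \<comment> \<open>A new face: only the inserted ball contributes to its link.\<close>
    then have "\<sigma> \<notin> rest" "\<alpha> - \<sigma> = V"
      using \<open>\<sigma> \<subseteq> W\<close> in_X_iff by (auto simp: rest_def V_def W)
    then have "link new_sphere \<sigma> = boundary_complex V"
      using \<open>\<sigma> \<subseteq> W\<close>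
      by (simp add: new_sphere_eq link_Un link_eq_empty[OF complex_rest] link_faces_avoiding
          boundary_complex_eq V_def)
    moreover have "V \<noteq> {}" "N - 1 - card \<sigma> = card V - 1"
      using V card by auto
    ultimately show ?thesis
      using strong_sphere_boundary_complex[OF V(1)] by simp
  next
    case False
    then have \<sigma>: "\<sigma> \<in> X" "\<sigma> \<in> rest"
      using True in_X_iff \<alpha> by (auto simp: rest_def)
    have "\<sigma> \<in> faces_avoiding W \<alpha> \<inter> faces_avoiding W \<beta>"
      using True False \<alpha> by (simp add: faces_avoiding_def)
    \<comment> \<open>\<sigma> misses a vertex of \<alpha> and one of \<beta>, which leaves room for
      the index shift to \<open>n\<close>.\<close>
    then have "card \<sigma> + 2 \<le> N"
      using card_faces_avoiding_Int[OF finW W[symmetric] disjoint] cardW by simp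
    then have "N - card \<sigma> = Suc (Suc (N - card \<sigma> - 2))"
      by simp
    then obtain n where n: "N - card \<sigma> = Suc (Suc n)"
      by blast
    then have n': "N - 1 - card \<sigma> = Suc n"
      by simp
    define a b where "a = \<alpha> - \<sigma>" and "b = \<beta> - \<sigma>"
    have ab: "a \<union> b = V" "b \<union> a = V" "a \<inter> b = {}" "b \<inter> a = {}" "a \<noteq> {}" "b \<noteq> {}"
      using \<alpha> False disjoint by (auto simp: a_def b_def V_def W)
    let ?R = "link rest \<sigma>"
    have cR: "simplicial_complex ?R"
      by (rule simplicial_complex_link[OF complex_rest \<sigma>(2)])
    have cF: "simplicial_complex (faces_avoiding V a)" "simplicial_complex (faces_avoiding V b)"
      by (simp_all add: simplicial_complex_faces_avoiding V ab)
    have lk: "link (faces_avoiding W \<alpha>) \<sigma> = faces_avoiding V a"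
      "link (faces_avoiding W \<beta>) \<sigma> = faces_avoiding V b"
      using True by (simp_all add: link_faces_avoiding a_def b_def V_def)
    have Int: "?R \<inter> faces_avoiding V b = faces_avoiding V a \<inter> faces_avoiding V b"
      "?R \<inter> faces_avoiding V a = faces_avoiding V b \<inter> faces_avoiding V a"
      using arg_cong[OF rest_Int(1), of "\<lambda>Y. link Y \<sigma>"] arg_cong[OF rest_Int(2), of "\<lambda>Y. link Y \<sigma>"]
      by (simp_all only: lk link_Int)
    have "strong_sphere (Suc n) (link X \<sigma>)"
      using sphere[OF \<sigma>(1)] by (simp only: n')
    moreover have "link X \<sigma> = ?R \<union> faces_avoiding V b"
      using arg_cong[OF old_sphere_eq, of "\<lambda>Y. link Y \<sigma>"] by (simp only: link_Un lk)
    ultimately have "strong_sphere (Suc n) (?R \<union> faces_avoiding V b)"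
      by simp
    moreover have "ball_pair n (faces_avoiding V b) (?R \<inter> faces_avoiding V b)"
      unfolding Int by (rule ball_pair_faces_avoiding) (use V ab n in auto)
    ultimately have "ball_pair n ?R (?R \<inter> faces_avoiding V b)"
      by (intro ball_pair_complement cR cF)
    then have "ball_pair n ?R (?R \<inter> faces_avoiding V a)"
      unfolding Int by (simp only: Int_commute)
    moreover have "ball_pair n (faces_avoiding V a) (?R \<inter> faces_avoiding V a)"
      unfolding Int by (rule ball_pair_faces_avoiding) (use V ab n in auto)
    ultimately have "strong_sphere (Suc n) (?R \<union> faces_avoiding V a)"
      by (intro strong_sphere_Un cR cF)
    moreover have "link new_sphere \<sigma> = ?R \<union> faces_avoiding V a"
      by (simp add: new_sphere_eq link_Un lk)
    ultimately show ?thesis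
      by (simp only: n')
  qed
  then show ?thesis
    using card by simp
qed

text \<open>The interior faces created by the gluing contain \<alpha>, which has at least
  \<open>N - k\<close> vertices because \<beta> has at most \<open>k\<close>.\<close>

lemma new_stacked:
  assumes "\<sigma> \<in> new_ball" "card \<sigma> + k < N"
  shows "\<sigma> \<in> new_sphere"
proof -
  have "\<not> \<alpha> \<subseteq> \<sigma>"
    using card_mono[OF face_finite[OF complex_new_ball assms(1)], of \<alpha>] assms(2) card_sum index by auto
  then show ?thesis
    using assms stacked[of \<sigma>] in_new_sphere_iff[of \<sigma>] link_outside(3,4)[of \<sigma>] by blast
qed

lemma stacked_filling_move: "stacked_filling k N new_sphere new_ball"
  unfolding stacked_filling_def
proof (intro conjI ballI impI)
  show "new_sphere \<subseteq> new_ball"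
    using sub by (auto simp: new_sphere_def new_ball_def faces_avoiding_def)
  show "card \<sigma> \<le> N" if "\<sigma> \<in> new_ball" for \<sigma>
    using that card_B card_mono[OF finW] cardW by (auto simp: new_ball_def)
  show "\<exists>\<sigma>\<in>new_ball. card \<sigma> = N"
    using cardW by (auto simp: new_ball_def)
qed (use complex_new_sphere complex_new_ball new_ball_interior new_ball_boundary new_sphere_links
    new_stacked in auto)

end

lemma stellated_sphere_stacked_filling:
  fixes X :: "'a::linorder complex"
  assumes "stellated_sphere k (int N - 2) X" "2 * k < N"
  shows "\<exists>B. stacked_filling k N X B"
  using assms(1)
proof induction
  case (standard \<alpha>)
  then show ?case
    using stacked_filling_simplex[of \<alpha> N k] assms(2) by (auto simp: face_dim_def)
next
  case (move X \<alpha> \<beta>)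
  then obtain B where B: "stacked_filling k N X B"
    by blast
  have adm: "finite \<alpha>" "finite \<beta>" "\<alpha> \<noteq> {}" "\<beta> \<noteq> {}" "\<alpha> \<inter> \<beta> = {}"
    "face_dim \<alpha> + face_dim \<beta> = int N - 2"
    "induced_subcomplex X (\<alpha> \<union> \<beta>) = join (full_simplex \<alpha>) (boundary_complex \<beta>)"
    using move.hyps(2) by (auto simp: bistellar_move_admissible_def)
  interpret admissible_move k N X B \<alpha> \<beta> "\<alpha> \<union> \<beta>"
  proof
    show "{\<sigma> \<in> X. \<sigma> \<subseteq> \<alpha> \<union> \<beta>} = faces_avoiding (\<alpha> \<union> \<beta>) \<beta>"
      using adm(7) join_full_simplex_boundary[OF adm(5)] by (simp add: induced_subcomplex_def)
  qed (use B adm assms(2) move.hyps(3) in \<open>auto simp: face_dim_def\<close>)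
  have "bistellar_move X \<alpha> \<beta> = new_sphere"
    unfolding bistellar_move_def new_sphere_def
    using join_full_simplex_boundary[OF adm(5)] join_boundary_full_simplex[OF adm(5)] by simp
  then show ?case
    using stacked_filling_move by metis
qed

section \<open>Comparison with reduced homology over the field with two elements\<close>

text \<open>Carried by integers, because \<open>stacked_homology_sphere\<close> asks for a field of
  type \<open>int ring\<close>.\<close>

abbreviation GF2 :: "int ring" where
  "GF2 \<equiv> residue_ring 2"

lemma field_GF2: "field GF2"
  using residues_prime.is_field[of 2] by (simp add: residues_prime_def two_is_prime_nat)

definition bit_to_int :: "bit \<Rightarrow> int" where
  "bit_to_int x = (if x = 0 then 0 else 1)"

definition int_chain :: "'a chain \<Rightarrow> 'a set \<Rightarrow> int" where
  "int_chain c = (\<lambda>\<sigma>. bit_to_int (c \<sigma>))"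

lemma GF2_simps:
  "carrier GF2 = {0, 1}" "\<zero>\<^bsub>GF2\<^esub> = 0" "\<one>\<^bsub>GF2\<^esub> = 1"
  "a \<oplus>\<^bsub>GF2\<^esub> b = (a + b) mod 2" "a \<otimes>\<^bsub>GF2\<^esub> b = (a * b) mod 2"
  by (auto simp: residue_ring_def)

lemma bit_to_int_inject: "bit_to_int x = bit_to_int y \<longleftrightarrow> x = y"
  by (cases x; cases y) (simp_all add: bit_to_int_def)

lemma bit_to_int_in_GF2: "bit_to_int x \<in> carrier GF2"
  by (simp add: GF2_simps bit_to_int_def)

lemma bit_to_int_add: "bit_to_int x \<oplus>\<^bsub>GF2\<^esub> bit_to_int y = bit_to_int (x + y)"
  by (cases x; cases y) (simp_all add: GF2_simps bit_to_int_def)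

text \<open>This makes the orientation signs in \<open>chain_boundary\<close> disappear.\<close>

lemma bit_to_int_minus: "\<ominus>\<^bsub>GF2\<^esub> bit_to_int x = bit_to_int x"
proof -
  interpret field GF2
    by (rule field_GF2)
  have "bit_to_int x \<oplus>\<^bsub>GF2\<^esub> bit_to_int x = \<zero>\<^bsub>GF2\<^esub>"
    unfolding bit_to_int_add by (simp add: GF2_simps bit_to_int_def)
  then show ?thesis
    using bit_to_int_in_GF2 by (intro minus_equality)
qed

lemma bit_to_int_sum:
  assumes "finite A"
  shows "(\<Oplus>\<^bsub>GF2\<^esub>v\<in>A. bit_to_int (f v)) = bit_to_int (\<Sum>v\<in>A. f v)"
proof -
  interpret field GF2
    by (rule field_GF2)
  show ?thesis
    using assms
  proof induction
    case empty
    then show ?case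
      by (simp add: GF2_simps bit_to_int_def)
  next
    case (insert v A)
    then show ?case
      using bit_to_int_in_GF2 by (simp add: bit_to_int_add)
  qed
qed

lemma int_chain_add: "int_chain (c + d) = (\<lambda>\<sigma>. int_chain c \<sigma> \<oplus>\<^bsub>GF2\<^esub> int_chain d \<sigma>)"
  by (simp add: int_chain_def bit_to_int_add)

lemma int_chain_0: "int_chain 0 = (\<lambda>\<sigma>. \<zero>\<^bsub>GF2\<^esub>)"
  by (simp add: int_chain_def bit_to_int_def GF2_simps)

lemma inj_int_chain: "inj int_chain"
  by (rule injI) (simp add: int_chain_def fun_eq_iff bit_to_int_inject)

section \<open>Graded cycles, boundaries and homology classes\<close>

definition graded_chains :: "'a complex \<Rightarrow> int \<Rightarrow> 'a chain set" where
  "graded_chains X i = {c. chain_on X c \<and> (\<forall>\<sigma>. c \<sigma> \<noteq> 0 \<longrightarrow> face_dim \<sigma> = i)}"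

definition graded_cycles :: "'a complex \<Rightarrow> int \<Rightarrow> 'a chain set" where
  "graded_cycles X i = {c \<in> graded_chains X i. bd c = 0}"

definition graded_boundaries :: "'a complex \<Rightarrow> int \<Rightarrow> 'a chain set" where
  "graded_boundaries X i = bd ` graded_chains X (i + 1)"

lemma carrier_chain_module: "carrier (chain_module GF2 X i) = int_chain ` graded_chains X i"
proof (intro equalityI subsetI)
  fix c assume c: "c \<in> carrier (chain_module GF2 X i)"
  define e :: "'a chain" where "e = (\<lambda>\<sigma>. of_bool (c \<sigma> \<noteq> 0))"
  have "c = int_chain e"
    using c by (auto simp: chain_module_def e_def int_chain_def bit_to_int_def GF2_simps fun_eq_iff)
  moreover have "e \<in> graded_chains X i"
    using c by (auto simp: chain_module_def graded_chains_def chain_on_def e_def GF2_simps)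
  ultimately show "c \<in> int_chain ` graded_chains X i"
    by blast
next
  fix c assume "c \<in> int_chain ` graded_chains X i"
  then obtain e where e: "c = int_chain e" "chain_on X e" "\<And>\<sigma>. e \<sigma> \<noteq> 0 \<Longrightarrow> face_dim \<sigma> = i"
    by (auto simp: graded_chains_def)
  have "c \<sigma> = \<zero>\<^bsub>GF2\<^esub>" if "\<not> (\<sigma> \<in> X \<and> face_dim \<sigma> = i)" for \<sigma>
    using e(3)[of \<sigma>] e(2) that
    by (cases "e \<sigma>") (auto simp: e(1) int_chain_def bit_to_int_def GF2_simps chain_on_def)
  then show "c \<in> carrier (chain_module GF2 X i)"
    using bit_to_int_in_GF2 by (simp add: chain_module_def e(1) int_chain_def)
qed

text \<open>The signs have no effect, and vertices \<open>v\<close> with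
  \<open>insert v \<tau>\<close> outside \<open>X\<close> contribute zero, so both boundaries are
  the same finite sum.\<close>

lemma chain_boundary_int_chain:
  fixes X :: "'a::linorder complex"
  assumes X: "simplicial_complex X" and c: "chain_on X c"
  shows "chain_boundary GF2 X (int_chain c) = int_chain (bd c)"
proof
  fix \<tau>
  let ?A = "{v. v \<notin> \<tau> \<and> insert v \<tau> \<in> X}"
  have sub: "?A \<subseteq> \<Union>X - \<tau>"
    by auto
  have fin: "finite (\<Union>X)"
    by (rule finite_Union_complex[OF X])
  have "bd c \<tau> = (\<Sum>v\<in>\<Union>X - \<tau>. c (insert v \<tau>))"
    by (rule bd_eq_sum[OF fin subset_refl c])
  also have "\<dots> = (\<Sum>v\<in>?A. c (insert v \<tau>))"
    using c fin sub by (intro sum.mono_neutral_right) (auto simp: chain_on_def)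
  finally have eq: "bd c \<tau> = (\<Sum>v\<in>?A. c (insert v \<tau>))" .
  have "finite ?A"
    using fin sub by (meson finite_Diff finite_subset)
  moreover have "(if P then bit_to_int x else \<ominus>\<^bsub>GF2\<^esub> bit_to_int x) = bit_to_int x" for P x
    by (simp add: bit_to_int_minus)
  ultimately show "chain_boundary GF2 X (int_chain c) \<tau> = int_chain (bd c) \<tau>"
    by (simp add: chain_boundary_def int_chain_def bit_to_int_sum eq)
qed

lemma carrier_cycle_module:
  fixes X :: "'a::linorder complex"
  assumes X: "simplicial_complex X"
  shows "carrier (cycle_module GF2 X i) = int_chain ` graded_cycles X i"
proof -
  have "chain_boundary GF2 X (int_chain c) = (\<lambda>\<tau>. \<zero>\<^bsub>GF2\<^esub>) \<longleftrightarrow> bd c = 0"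
    if "c \<in> graded_chains X i" for c
  proof -
    have "chain_on X c"
      using that by (simp add: graded_chains_def)
    then show ?thesis
      unfolding int_chain_0[symmetric] by (simp only: chain_boundary_int_chain[OF X] inj_eq[OF inj_int_chain])
  qed
  then show ?thesis
    by (auto simp: cycle_module_def carrier_chain_module graded_cycles_def)
qed

lemma boundaries_eq:
  fixes X :: "'a::linorder complex"
  assumes X: "simplicial_complex X"
  shows "boundaries GF2 X i = int_chain ` graded_boundaries X i"
  unfolding boundaries_def carrier_chain_module graded_boundaries_def image_image
  using chain_boundary_int_chain[OF X] by (intro image_cong) (auto simp: graded_chains_def)

lemma cycle_module_ops:
  "c \<oplus>\<^bsub>cycle_module F X i\<^esub> d = (\<lambda>\<sigma>. c \<sigma> \<oplus>\<^bsub>F\<^esub> d \<sigma>)"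
  "a \<odot>\<^bsub>cycle_module F X i\<^esub> c = (\<lambda>\<sigma>. a \<otimes>\<^bsub>F\<^esub> c \<sigma>)"
  by (simp_all add: cycle_module_def chain_module_def)

definition homology_class :: "'a complex \<Rightarrow> int \<Rightarrow> 'a chain \<Rightarrow> ('a set \<Rightarrow> int) set" where
  "homology_class X i e = int_chain ` {b + e | b. b \<in> graded_boundaries X i}"

lemma coset_eq_homology_class:
  fixes X :: "'a::linorder complex"
  assumes "simplicial_complex X"
  shows "boundaries GF2 X i +>\<^bsub>cycle_module GF2 X i\<^esub> int_chain e = homology_class X i e"
  unfolding a_r_coset_def r_coset_def boundaries_eq[OF assms] homology_class_def
  by (auto simp: cycle_module_ops simp flip: int_chain_add)

lemma carrier_reduced_homology:
  fixes X :: "'a::linorder complex"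
  assumes "simplicial_complex X"
  shows "carrier (reduced_homology GF2 X i) = homology_class X i ` graded_cycles X i"
proof -
  have "carrier (reduced_homology GF2 X i) =
      (\<lambda>c. boundaries GF2 X i +>\<^bsub>cycle_module GF2 X i\<^esub> c) ` carrier (cycle_module GF2 X i)"
    by (auto simp: reduced_homology_def quotient_module_def A_RCOSETS_def RCOSETS_def a_r_coset_def)
  then show ?thesis
    by (simp add: carrier_cycle_module[OF assms] image_image coset_eq_homology_class[OF assms])
qed

lemma zero_reduced_homology:
  fixes X :: "'a::linorder complex"
  assumes "simplicial_complex X"
  shows "\<zero>\<^bsub>reduced_homology GF2 X i\<^esub> = homology_class X i 0"
  by (simp add: reduced_homology_def quotient_module_def boundaries_eq[OF assms] homology_class_def)

lemma graded_chains_add: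
  "c \<in> graded_chains X i \<Longrightarrow> d \<in> graded_chains X i \<Longrightarrow> c + d \<in> graded_chains X i"
  unfolding graded_chains_def using chain_on_add[of X c d] by fastforce

lemma graded_boundaries_add:
  assumes X: "simplicial_complex X" and "c \<in> graded_boundaries X i" "d \<in> graded_boundaries X i"
  shows "c + d \<in> graded_boundaries X i"
proof -
  obtain a b where ab: "a \<in> graded_chains X (i + 1)" "b \<in> graded_chains X (i + 1)" "c = bd a" "d = bd b"
    using assms by (auto simp: graded_boundaries_def)
  then have "c + d = bd (a + b)"
    using bd_add[OF X, of a b] by (simp add: graded_chains_def)
  then show ?thesis
    using graded_chains_add[OF ab(1,2)] by (simp add: graded_boundaries_def)
qed

lemma zero_graded_boundaries: "0 \<in> graded_boundaries X i"
  unfolding graded_boundaries_def by (rule image_eqI[of _ _ 0]) (auto simp: graded_chains_def)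

lemma homology_class_eq_iff:
  fixes X :: "'a::linorder complex"
  assumes X: "simplicial_complex X"
  shows "homology_class X i c = homology_class X i d \<longleftrightarrow> c + d \<in> graded_boundaries X i"
proof
  assume "homology_class X i c = homology_class X i d"
  then have "{b + c | b. b \<in> graded_boundaries X i} = {b + d | b. b \<in> graded_boundaries X i}"
    unfolding homology_class_def by (simp only: inj_image_eq_iff[OF inj_int_chain])
  moreover have "c \<in> {b + c | b. b \<in> graded_boundaries X i}"
    using zero_graded_boundaries by force
  ultimately have "c \<in> {b + d | b. b \<in> graded_boundaries X i}"
    by (simp only:)
  then show "c + d \<in> graded_boundaries X i"
    by (auto simp: add.assoc)
next
  have sub: "{b + c | b. b \<in> graded_boundaries X i} \<subseteq> {b + d | b. b \<in> graded_boundaries X i}"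
    if "c + d \<in> graded_boundaries X i" for c d :: "'a chain"
  proof clarify
    fix b assume "b \<in> graded_boundaries X i"
    then have "b + (c + d) \<in> graded_boundaries X i"
      using graded_boundaries_add[OF X] that by blast
    moreover have "b + c = b + (c + d) + d"
      by (simp add: add.assoc)
    ultimately show "\<exists>b'. b + c = b' + d \<and> b' \<in> graded_boundaries X i"
      by blast
  qed
  assume "c + d \<in> graded_boundaries X i"
  then show "homology_class X i c = homology_class X i d"
    using sub[of c d] sub[of d c] unfolding homology_class_def by (simp add: add.commute)
qed

lemma trivial_homology:
  fixes X :: "'a::linorder complex"
  assumes X: "simplicial_complex X" and "graded_cycles X i \<subseteq> graded_boundaries X i"
  shows "carrier (reduced_homology GF2 X i) = {\<zero>\<^bsub>reduced_homology GF2 X i\<^esub>}"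
proof -
  have "0 \<in> graded_cycles X i"
    by (simp add: graded_cycles_def graded_chains_def)
  moreover have "homology_class X i c = homology_class X i 0" if "c \<in> graded_cycles X i" for c
    using that assms(2) by (auto simp: homology_class_eq_iff[OF X])
  ultimately show ?thesis
    unfolding carrier_reduced_homology[OF X] zero_reduced_homology[OF X] by blast
qed

text \<open>Over two elements a one-dimensional space has just two points, so an isomorphism can be
  verified case by case.\<close>

lemma one_dimensional_homology:
  fixes X :: "'a::linorder complex"
  assumes X: "simplicial_complex X" and f: "f \<in> graded_cycles X i" "f \<notin> graded_boundaries X i"
    and gen: "\<And>c. c \<in> graded_cycles X i \<Longrightarrow> c \<in> graded_boundaries X i \<or> c + f \<in> graded_boundaries X i"
  shows "isomorphic_to_field GF2 (reduced_homology GF2 X i)"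
proof -
  let ?H = "reduced_homology GF2 X i" and ?cl = "homology_class X i"
  have "0 \<in> graded_cycles X i"
    by (simp add: graded_cycles_def graded_chains_def)
  moreover have "?cl c = ?cl 0 \<or> ?cl c = ?cl f" if "c \<in> graded_cycles X i" for c
    using gen[OF that] by (simp add: homology_class_eq_iff[OF X])
  ultimately have carrier: "carrier ?H = {?cl 0, ?cl f}"
    unfolding carrier_reduced_homology[OF X] using f(1) by blast
  have neq: "?cl 0 \<noteq> ?cl f" "?cl f \<noteq> ?cl 0"
    using f(2) by (simp_all add: homology_class_eq_iff[OF X])
  have add: "?cl c \<oplus>\<^bsub>?H\<^esub> ?cl d = ?cl (c + d)" for c d
  proof -
    have "?cl c \<oplus>\<^bsub>?H\<^esub> ?cl d = {int_chain (b + c + (b' + d)) | b b'.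
        b \<in> graded_boundaries X i \<and> b' \<in> graded_boundaries X i}"
      unfolding reduced_homology_def quotient_module_def homology_class_def
      by (auto simp: set_add_def set_mult_def cycle_module_ops simp flip: int_chain_add)
    also have "\<dots> = ?cl (c + d)"
    proof (intro equalityI subsetI)
      fix x assume "x \<in> {int_chain (b + c + (b' + d)) | b b'.
        b \<in> graded_boundaries X i \<and> b' \<in> graded_boundaries X i}"
      then obtain b b' where "x = int_chain (b + c + (b' + d))"
        "b \<in> graded_boundaries X i" "b' \<in> graded_boundaries X i"
        by blast
      moreover have "b + c + (b' + d) = (b + b') + (c + d)"
        by (simp add: ac_simps)
      ultimately show "x \<in> ?cl (c + d)"
        using graded_boundaries_add[OF X] unfolding homology_class_def by blast
    next
      fix x assume "x \<in> ?cl (c + d)"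
      then obtain b where b: "x = int_chain (b + (c + d))" "b \<in> graded_boundaries X i"
        unfolding homology_class_def by blast
      then have "x = int_chain (b + c + (0 + d))"
        by (simp add: ac_simps)
      then show "x \<in> {int_chain (b + c + (b' + d)) | b b'.
        b \<in> graded_boundaries X i \<and> b' \<in> graded_boundaries X i}"
        using b(2) zero_graded_boundaries by blast
    qed
    finally show ?thesis .
  qed
  have mem: "\<exists>e. x = int_chain e \<and> ?cl e = ?cl c" if x: "x \<in> ?cl c" for x c
  proof -
    obtain b where b: "x = int_chain (b + c)" "b \<in> graded_boundaries X i"
      using x unfolding homology_class_def by blast
    then have "?cl (b + c) = ?cl c"
      by (simp add: homology_class_eq_iff[OF X] add.assoc)
    then show ?thesis
      using b(1) by blast
  qed
  \<comment> \<open>The quotient multiplies a class by a scalar as a union over its representatives.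
    Each representative gives the same coset and the class is not empty, so the union
    collapses.\<close>
  have smult: "a \<odot>\<^bsub>?H\<^esub> ?cl c = (\<Union>x\<in>?cl c. boundaries GF2 X i +>\<^bsub>cycle_module GF2 X i\<^esub>
      (\<lambda>\<sigma>. a \<otimes>\<^bsub>GF2\<^esub> x \<sigma>))" for a c
    by (simp add: reduced_homology_def quotient_module_def cycle_module_ops)
  have ne: "?cl c \<noteq> {}" for c
    using zero_graded_boundaries[of X i] by (auto simp: homology_class_def)
  have smult0: "0 \<odot>\<^bsub>?H\<^esub> ?cl c = ?cl 0" for c
  proof -
    have "(\<lambda>\<sigma>. 0 \<otimes>\<^bsub>GF2\<^esub> x \<sigma>) = int_chain 0" for x :: "'a set \<Rightarrow> int"
      by (simp add: int_chain_0 GF2_simps)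
    then show ?thesis
      unfolding smult using ne by (simp add: coset_eq_homology_class[OF X])
  qed
  have smult1: "1 \<odot>\<^bsub>?H\<^esub> ?cl c = ?cl c" for c
  proof -
    have one: "(\<lambda>\<sigma>. 1 \<otimes>\<^bsub>GF2\<^esub> int_chain e \<sigma>) = int_chain e" for e :: "'a chain"
      by (simp add: int_chain_def bit_to_int_def GF2_simps fun_eq_iff)
    have "boundaries GF2 X i +>\<^bsub>cycle_module GF2 X i\<^esub> (\<lambda>\<sigma>. 1 \<otimes>\<^bsub>GF2\<^esub> x \<sigma>) = ?cl c" if "x \<in> ?cl c" for x
      using mem[OF that] one coset_eq_homology_class[OF X] by metis
    then show ?thesis
      unfolding smult using ne by simp
  qed
  define h :: "('a set \<Rightarrow> int) set \<Rightarrow> int" where "h = (\<lambda>K. if K = ?cl 0 then 0 else 1)"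
  show ?thesis
    unfolding isomorphic_to_field_def carrier
  proof (intro exI[of _ h] conjI)
    show "bij_betw h {?cl 0, ?cl f} (carrier GF2)"
      using neq by (auto simp: bij_betw_def h_def GF2_simps)
    show "\<forall>x\<in>{?cl 0, ?cl f}. \<forall>y\<in>{?cl 0, ?cl f}. h (x \<oplus>\<^bsub>?H\<^esub> y) = h x \<oplus>\<^bsub>GF2\<^esub> h y"
      using neq by (auto simp: add h_def GF2_simps)
    show "\<forall>a\<in>carrier GF2. \<forall>x\<in>{?cl 0, ?cl f}. h (a \<odot>\<^bsub>?H\<^esub> x) = a \<otimes>\<^bsub>GF2\<^esub> h x"
      using neq by (auto simp: smult0 smult1 h_def GF2_simps)
  qed
qed

text \<open>The passage from ungraded to graded homology. Agreement is asked in degree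
  \<open>i\<close> only, so a cycle of the form \<open>bd y + f\<close> is also bounded in every
  degree in which \<open>f\<close> vanishes.\<close>

lemma bounding_in_degree:
  fixes X :: "'a::linorder complex"
  assumes X: "simplicial_complex X" and y: "chain_on X y" and c: "c \<in> graded_cycles X i"
    and bd: "\<And>\<sigma>. face_dim \<sigma> = i \<Longrightarrow> bd y \<sigma> = c \<sigma>"
  shows "c \<in> graded_boundaries X i"
proof (cases "i < -1")
  case True
  have "face_dim \<sigma> \<noteq> i" for \<sigma> :: "'a set"
    using True by (auto simp: face_dim_def)
  then have "c \<sigma> = 0" for \<sigma>
    using c by (cases "c \<sigma>") (auto simp: graded_cycles_def graded_chains_def)
  then have "c = 0"
    by (simp add: fun_eq_iff)
  then show ?thesis
    using zero_graded_boundaries by simp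
next
  case False
  \<comment> \<open>The number of vertices of a face of dimension \<open>i\<close>; the conversion
    is faithful because \<open>i\<close> is at least -1 here.\<close>
  define m where "m = nat (i + 1)"
  have dim: "face_dim \<sigma> = i \<longleftrightarrow> card \<sigma> = m" "face_dim \<sigma> = i + 1 \<longleftrightarrow> card \<sigma> = Suc m" for \<sigma> :: "'a set"
    using False by (auto simp: face_dim_def m_def)
  let ?y = "restrict_chain y {\<sigma>. card \<sigma> = Suc m}"
  have "?y \<in> graded_chains X (i + 1)"
    using y by (auto simp: graded_chains_def chain_on_def restrict_chain_def dim)
  moreover have "bd ?y = c"
  proof
    fix \<sigma>
    show "bd ?y \<sigma> = c \<sigma>"
      using bd[of \<sigma>] c unfolding bd_restrict_card[OF X y]
      by (cases "c \<sigma>") (auto simp: restrict_chain_def dim graded_cycles_def graded_chains_def)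
  qed
  ultimately show ?thesis
    unfolding graded_boundaries_def by blast
qed

lemma acyclic_complex_GF2:
  fixes X :: "'a::linorder complex"
  assumes X: "simplicial_complex X" and "mod2_acyclic X"
  shows "acyclic_complex GF2 X"
  unfolding acyclic_complex_def
proof (intro allI trivial_homology[OF X] subsetI)
  fix i c assume c: "c \<in> graded_cycles X i"
  then obtain y where "chain_on X y" "bd y = c"
    using mod2_acyclicD[OF assms(2)] unfolding graded_cycles_def graded_chains_def by blast
  then show "c \<in> graded_boundaries X i"
    using bounding_in_degree[OF X _ c] by blast
qed

lemma has_homology_of_sphere_GF2:
  fixes X :: "'a::linorder complex"
  assumes X: "simplicial_complex X" and "weak_sphere n X"
  shows "has_homology_of_sphere GF2 (int n - 1) X"
proof -
  obtain f where f: "generated_by_cycle X f" "\<And>\<sigma>. f \<sigma> \<noteq> 0 \<Longrightarrow> card \<sigma> = n"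
    using assms(2) unfolding weak_sphere_def by blast
  have f0: "f \<sigma> = 0" if "face_dim \<sigma> \<noteq> int n - 1" for \<sigma>
    using f(2)[of \<sigma>] that by (cases "f \<sigma>") (auto simp: face_dim_def)
  have fZ: "f \<in> graded_cycles X (int n - 1)"
    using f f0 unfolding graded_cycles_def graded_chains_def generated_by_cycle_def by blast
  have fB: "f \<notin> graded_boundaries X i" for i
    using f(1) unfolding graded_boundaries_def graded_chains_def generated_by_cycle_def by blast
  have split: "\<exists>y. chain_on X y \<and> (c = bd y \<or> c = bd y + f)" if "c \<in> graded_cycles X i" for c i
    using that f(1) unfolding graded_cycles_def graded_chains_def generated_by_cycle_def by blast
  show ?thesis
    unfolding has_homology_of_sphere_def
  proof (intro allI)
    fix i
    have "carrier (reduced_homology GF2 X i) = {\<zero>\<^bsub>reduced_homology GF2 X i\<^esub>}" if i: "i \<noteq> int n - 1"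
    proof (intro trivial_homology[OF X] subsetI)
      fix c assume c: "c \<in> graded_cycles X i"
      obtain y where y: "chain_on X y" "c = bd y \<or> c = bd y + f"
        using split[OF c] by blast
      then have "bd y \<sigma> = c \<sigma>" if "face_dim \<sigma> = i" for \<sigma>
        using f0[of \<sigma>] that i by auto
      then show "c \<in> graded_boundaries X i"
        by (rule bounding_in_degree[OF X y(1) c])
    qed
    moreover have "isomorphic_to_field GF2 (reduced_homology GF2 X (int n - 1))"
    proof (rule one_dimensional_homology[OF X fZ fB])
      fix c assume c: "c \<in> graded_cycles X (int n - 1)"
      obtain y where y: "chain_on X y" "c = bd y \<or> c = bd y + f"
        using split[OF c] by blast
      from y(2) show "c \<in> graded_boundaries X (int n - 1) \<or> c + f \<in> graded_boundaries X (int n - 1)"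
      proof
        assume "c = bd y"
        then show ?thesis
          using bounding_in_degree[OF X y(1) c] by blast
      next
        assume "c = bd y + f"
        then have eq: "c + f = bd y"
          by (simp add: add.assoc)
        have "c + f \<in> graded_cycles X (int n - 1)"
          using graded_chains_add[of c X _ f] c fZ bd_bd[OF X y(1)] unfolding graded_cycles_def eq
          by (simp add: eq)
        then show ?thesis
          using bounding_in_degree[OF X y(1), of "c + f"] eq by simp
      qed
    qed
    ultimately show "if i = int n - 1 then isomorphic_to_field GF2 (reduced_homology GF2 X i)
        else carrier (reduced_homology GF2 X i) = {\<zero>\<^bsub>reduced_homology GF2 X i\<^esub>}"
      by simp
  qed
qed

text \<open>The homology would have both one and two elements. This keeps interior faces out of
  \<open>ball_boundary\<close>.\<close>

lemma sphere_not_acyclic_GF2: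
  assumes "has_homology_of_sphere GF2 n X"
  shows "\<not> acyclic_complex GF2 X"
proof
  assume "acyclic_complex GF2 X"
  then have "card (carrier (reduced_homology GF2 X n)) = 1"
    by (simp add: acyclic_complex_def)
  moreover have "isomorphic_to_field GF2 (reduced_homology GF2 X n)"
    using assms by (simp add: has_homology_of_sphere_def)
  then have "card (carrier (reduced_homology GF2 X n)) = card (carrier GF2)"
    unfolding isomorphic_to_field_def by (blast dest: bij_betw_same_card)
  ultimately show False
    by (simp add: GF2_simps)
qed

section \<open>From fillings to stacked homology spheres\<close>

lemma dim_complexI:
  assumes "simplicial_complex X" "\<And>\<sigma>. \<sigma> \<in> X \<Longrightarrow> face_dim \<sigma> \<le> d" "\<phi> \<in> X" "face_dim \<phi> = d"
  shows "dim_complex d X"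
proof -
  have "finite X"
    using assms(1) by (simp add: simplicial_complex_def)
  then have "Max (face_dim ` X) = d"
    using assms(2-4) by (intro Max_eqI) auto
  then show ?thesis
    using assms(1) by (simp add: dim_complex_def complex_dim_def)
qed

lemma stacked_filling_imp_stacked_homology_sphere:
  fixes X B :: "'a::linorder complex"
  assumes fill: "stacked_filling k N X B" and N: "N \<ge> 1"
  shows "stacked_homology_sphere k (int N - 2) X"
proof -
  have cX: "simplicial_complex X" and cB: "simplicial_complex B" and sub: "X \<subseteq> B"
    and card_B: "\<And>\<sigma>. \<sigma> \<in> B \<Longrightarrow> card \<sigma> \<le> N" and facet: "\<exists>\<sigma>\<in>B. card \<sigma> = N"
    and int: "\<And>\<sigma>. \<sigma> \<in> B \<Longrightarrow> \<sigma> \<notin> X \<Longrightarrow> weak_sphere (N - card \<sigma>) (link B \<sigma>)"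
    and bnd: "\<And>\<sigma>. \<sigma> \<in> X \<Longrightarrow> mod2_acyclic (link B \<sigma>)"
    and card_X: "\<And>\<sigma>. \<sigma> \<in> X \<Longrightarrow> card \<sigma> < N"
    and sph: "\<And>\<sigma>. \<sigma> \<in> X \<Longrightarrow> strong_sphere (N - 1 - card \<sigma>) (link X \<sigma>)"
    and stk: "\<And>\<sigma>. \<sigma> \<in> B \<Longrightarrow> card \<sigma> + k < N \<Longrightarrow> \<sigma> \<in> X"
    using fill unfolding stacked_filling_def by blast+
  have empty: "{} \<in> X"
    by (rule empty_face[OF cX])
  have B_int: "has_homology_of_sphere GF2 (int N - 1 - face_dim \<sigma> - 1) (link B \<sigma>)"
    if "\<sigma> \<in> B" "\<sigma> \<notin> X" for \<sigma>
  proof -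
    have "int N - 1 - face_dim \<sigma> - 1 = int (N - card \<sigma>) - 1"
      using card_B[OF that(1)] by (simp add: face_dim_def of_nat_diff)
    then show ?thesis
      using has_homology_of_sphere_GF2[OF simplicial_complex_link[OF cB that(1)] int[OF that]] by simp
  qed
  have B_bnd: "acyclic_complex GF2 (link B \<sigma>)" if "\<sigma> \<in> X" for \<sigma>
    using acyclic_complex_GF2[OF simplicial_complex_link[OF cB] bnd[OF that]] that sub by blast
  have X_link: "has_homology_of_sphere GF2 (int N - 2 - face_dim \<sigma> - 1) (link X \<sigma>)"
    if "\<sigma> \<in> X" for \<sigma>
  proof -
    have "int N - 2 - face_dim \<sigma> - 1 = int (N - 1 - card \<sigma>) - 1"
      using card_X[OF that] by (simp add: face_dim_def of_nat_diff)
    then show ?thesis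
      using has_homology_of_sphere_GF2[OF simplicial_complex_link[OF cX that]
          strong_sphere_imp_weak_sphere[OF sph[OF that]]] by simp
  qed
  \<comment> \<open>Faces of \<open>X\<close> have acyclic links in \<open>B\<close> and the other
    faces do not, so the boundary defined by homology is the sphere carried along by the
    induction.\<close>
  have boundary_eq: "ball_boundary GF2 B = X"
    unfolding ball_boundary_def using B_bnd sub sphere_not_acyclic_GF2[OF B_int] by blast
  obtain \<phi> where "\<phi> \<in> X" "card \<phi> = N - 1"
    using strong_sphere_facet[OF sph[OF empty]] by (auto simp: link_empty)
  then have "dim_complex (int N - 2) X"
    using card_X N by (intro dim_complexI[OF cX, of _ \<phi>]) (force simp: face_dim_def)+
  then have X: "homology_sphere_over GF2 (int N - 2) X"
    using X_link by (simp add: homology_sphere_over_def)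
  obtain \<psi> where "\<psi> \<in> B" "card \<psi> = N"
    using facet by blast
  then have "dim_complex (int N - 1) B"
    using card_B by (intro dim_complexI[OF cB, of _ \<psi>]) (force simp: face_dim_def)+
  moreover have "acyclic_complex GF2 B"
    using B_bnd[OF empty] by (simp add: link_empty)
  ultimately have "homology_ball_over GF2 (int N - 1) B"
    unfolding homology_ball_over_def boundary_eq using B_int B_bnd X by auto
  then have "stacked_homology_ball_over GF2 k (int N - 1) B"
    unfolding stacked_homology_ball_over_def boundary_eq using stk by (auto simp: face_dim_def)
  then show ?thesis
    unfolding stacked_homology_sphere_def using field_GF2 X boundary_eq
    by (intro exI[of _ GF2] conjI exI[of _ B]) auto
qed

theorem corollary2p18:
  fixes k d :: nat
  assumes "d \<ge> 1" and "d \<ge> 2 * k"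
  shows "(\<W> k d :: 'a::{linorder, infinite} complex set) \<subseteq> \<K> k d"
proof
  fix X :: "'a complex"
  assume X: "X \<in> \<W> k d"
  have "stacked_homology_sphere k (int d - 1) (link X {v})" if "v \<in> vertices X" for v
  proof -
    \<comment> \<open>The link has dimension \<open>d - 1\<close>, so a facet of its filling has
      \<open>N = Suc d\<close> vertices, and \<open>d \<ge> 2 * k\<close> reads
      \<open>2 * k < N\<close>.\<close>
    have "stellated_sphere k (int (Suc d) - 2) (link X {v})"
      using X that by (simp add: stellated_class_def)
    then obtain B where "stacked_filling k (Suc d) (link X {v}) B"
      using stellated_sphere_stacked_filling[of k "Suc d"] assms(2) by auto
    then show ?thesis
      using stacked_filling_imp_stacked_homology_sphere[of k "Suc d"] by simp
  qed
  then show "X \<in> \<K> k d"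
    using X by (simp add: stellated_class_def stacked_class_def)
qed

end
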